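(* Let $(Y,h:Y\to\mathbb C^N)$ be a hybrid LG model of rank $N$. For all $k_1,k_2\ge0$ and all integers $0\le a_1,a_2\le N$, the perverse Leray filtration $P_\bullet=P^h_\bullet$ associated to $h$ satisfies the following under the cup product: $$\cup:\ P_{k_1+a_1}H^{k_1}(Y;\mathbb C)\otimes P_{k_2+a_2}H^{k_2}(Y;\mathbb C)\longrightarrow P_{k_1+k_2+\min(a_1,a_2)}H^{k_1+k_2}(Y;\mathbb C).$$
   Context: Hybrid LG model of rank $N\ge1$: a triple $(Y,\omega,h=(h_1,\dots,h_N):Y\to\mathbb C^N)$ ($\omega$ is often omitted) where (1) $(Y,\omega)$ is an $n$-dimensional complex Kähler Calabi–Yau manifold with Kähler form $\omega$; (2) $h$ is a proper surjective holomorphic map such that: (a) there is $R>0$ such that for every non-empty $I\subset\{1,\dots,N\}$ the map $h_I=(h_i)_{i\in I}:Y\to\mathbb C^{|I|}$ is a locally trivial fibration with smooth fibres over $B_I=\{|z_i|>R\ \forall i\in I\}$, and over $B_I$ one has $v(h_j)=0$ for every horizontal vector field $v$ associated to $h_I$ and every $j\notin I$ (i.e. the local trivializations of $h_I$ preserve $h_j$ for $j\notin I$); (b) for $I\subset J$ these local trivializations are compatible under the natural inclusions $B_J\times\mathbb C^{N-|J|}\subset B_I\times\mathbb C^{N-|I|}\subset\mathbb C^N$. Perverse Leray filtration: $P^h_lH^k(Y;\mathbb C)=\mathrm{Im}\big(\mathbb H^k(\mathbb C^N,{}^{\mathfrak p}\tau_{\le l}Rh_*\mathbb C_Y)\to H^k(Y;\mathbb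 C)\big)$, where ${}^{\mathfrak p}\tau$ is truncation for the middle perverse $t$-structure on the constructible derived category (no shift of $Rh_*\mathbb C_Y$). Equivalently, $P^h_lH^k(Y)=\ker(H^k(Y)\to H^k(h^{-1}(\Lambda_{l-k+1})))$ for a sufficiently general flag of affine subspaces of $\mathbb C^N$ with $\Lambda_r$ of codimension $r$ ($\Lambda_r=\emptyset$ for $r>N$). Thus $0=P_{k-1}\subset P_k\subset\dots\subset P_{k+N}=H^k(Y;\mathbb C)$. *)

theory Defs
  imports
    "HOL-Analysis.Analysis"
    "HOL-Algebra.Algebraic_Closure_Type"
    "HOL-Homology.Homology"
begin

section \<open>Smooth and holomorphic maps\<close>

primrec ck_on :: "nat \<Rightarrow> 'a::real_normed_vector set \<Rightarrow> ('a \<Rightarrow> 'b::real_normed_vector) \<Rightarrow> bool" where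
  "ck_on 0 S f \<longleftrightarrow> continuous_on S f"
| "ck_on (Suc k) S f \<longleftrightarrow>
     (\<exists>f'. (\<forall>x\<in>S. (f has_derivative f' x) (at x)) \<and> (\<forall>v. ck_on k S (\<lambda>x. f' x v)))"

definition smooth_on :: "'a::real_normed_vector set \<Rightarrow> ('a \<Rightarrow> 'b::real_normed_vector) \<Rightarrow> bool" where
  "smooth_on S f \<longleftrightarrow> (\<forall>k. ck_on k S f)"

definition holo_fun_on :: "(complex^'n) set \<Rightarrow> (complex^'n \<Rightarrow> complex) \<Rightarrow> bool" where
  "holo_fun_on S f \<longleftrightarrow>
     (\<forall>z\<in>S. \<exists>D. (f has_derivative D) (at z) \<and> (\<forall>c v. D (c *s v) = c * D v))"

definition holo_map_on :: "(complex^'n) set \<Rightarrow> (complex^'n \<Rightarrow> complex^'m) \<Rightarrow> bool" where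
  "holo_map_on S f \<longleftrightarrow> (\<forall>i. holo_fun_on S (\<lambda>z. f z $ i))"


section \<open>Complex manifolds, Kaehler forms, holomorphic volume forms\<close>

text \<open>A manifold is a second countable Hausdorff type with an atlas; a chart is a pair
  \<open>(U, \<phi>)\<close> of a domain and a coordinate map. The dimension is \<open>CARD('n)\<close>. Tensors are families
  of local representations indexed by the charts.\<close>

type_synonym ('y, 'n) chart = "'y set \<times> ('y \<Rightarrow> complex^'n)"

abbreviation chart_inv :: "('y, 'n) chart \<Rightarrow> complex^'n \<Rightarrow> 'y" where
  "chart_inv c \<equiv> inv_into (fst c) (snd c)"

definition transition :: "('y, 'n) chart \<Rightarrow> ('y, 'n) chart \<Rightarrow> complex^'n \<Rightarrow> complex^'n" where
  "transition c c' = snd c' \<circ> chart_inv c"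

definition complex_manifold ::
    "('y::{t2_space,second_countable_topology}, 'n::finite) chart set \<Rightarrow> bool" where
  "complex_manifold A \<longleftrightarrow>
     (\<Union>c\<in>A. fst c) = UNIV \<and>
     (\<forall>c\<in>A. open (fst c) \<and> open (snd c ` fst c) \<and>
        homeomorphism (fst c) (snd c ` fst c) (snd c) (chart_inv c)) \<and>
     (\<forall>c\<in>A. \<forall>c'\<in>A. holo_map_on (snd c ` (fst c \<inter> fst c')) (transition c c'))"

definition holo_map_from ::
    "('y, 'n::finite) chart set \<Rightarrow> ('y \<Rightarrow> complex^'m) \<Rightarrow> bool" where
  "holo_map_from A f \<longleftrightarrow> (\<forall>c\<in>A. holo_map_on (snd c ` fst c) (f \<circ> chart_inv c))"

type_synonym ('y, 'n) two_form =
  "('y, 'n) chart \<Rightarrow> complex^'n \<Rightarrow> complex^'n \<Rightarrow> complex^'n \<Rightarrow> real"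

definition kahler_form ::
    "('y, 'n::finite) chart set \<Rightarrow> ('y, 'n) two_form \<Rightarrow> bool" where
  "kahler_form A \<omega> \<longleftrightarrow>
     (\<forall>c\<in>A. \<forall>z\<in>snd c ` fst c.
        bilinear (\<omega> c z) \<and> (\<forall>v. \<omega> c z v v = 0) \<and>
        (\<forall>v w. \<omega> c z (\<i> *s v) (\<i> *s w) = \<omega> c z v w) \<and>
        (\<forall>v. v \<noteq> 0 \<longrightarrow> 0 < \<omega> c z v (\<i> *s v))) \<and>
     (\<forall>c\<in>A. \<forall>v w. smooth_on (snd c ` fst c) (\<lambda>z. \<omega> c z v w)) \<and>
     (\<forall>c\<in>A. \<forall>z\<in>snd c ` fst c. \<forall>u v w.
        frechet_derivative (\<lambda>z. \<omega> c z v w) (at z) u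
        + frechet_derivative (\<lambda>z. \<omega> c z w u) (at z) v
        + frechet_derivative (\<lambda>z. \<omega> c z u v) (at z) w = 0) \<and>
     (\<forall>c\<in>A. \<forall>c'\<in>A. \<forall>z\<in>snd c ` (fst c \<inter> fst c'). \<forall>v w.
        \<omega> c z v w =
          \<omega> c' (transition c c' z)
             (frechet_derivative (transition c c') (at z) v)
             (frechet_derivative (transition c c') (at z) w))"

definition complex_jacobian :: "(complex^'n \<Rightarrow> complex^'n) \<Rightarrow> complex^'n \<Rightarrow> complex^'n^'n" where
  "complex_jacobian f z = (\<chi> i j. frechet_derivative f (at z) (axis j 1) $ i)"

text \<open>Calabi--Yau means that the canonical bundle is trivial: in the chart \<open>c\<close> the holomorphic
  volume form is \<open>\<Omega> c dz\<^sub>1 \<and> \<dots> \<and> dz\<^sub>n\<close>.\<close>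

definition calabi_yau :: "('y, 'n::finite) chart set \<Rightarrow> bool" where
  "calabi_yau A \<longleftrightarrow>
     (\<exists>\<Omega>. (\<forall>c\<in>A. holo_fun_on (snd c ` fst c) (\<Omega> c) \<and> (\<forall>z\<in>snd c ` fst c. \<Omega> c z \<noteq> 0)) \<and>
          (\<forall>c\<in>A. \<forall>c'\<in>A. \<forall>z\<in>snd c ` (fst c \<inter> fst c').
             \<Omega> c z = \<Omega> c' (transition c c' z) * det (complex_jacobian (transition c c') z)))"

definition smooth_self_map_on ::
    "('y::topological_space, 'n::finite) chart set \<Rightarrow> 'y set \<Rightarrow> ('y \<Rightarrow> 'y) \<Rightarrow> bool" where
  "smooth_self_map_on A S f \<longleftrightarrow> continuous_on S f \<and>
     (\<forall>c\<in>A. \<forall>c'\<in>A. smooth_on (snd c ` (fst c \<inter> S \<inter> f -` fst c')) (snd c' \<circ> f \<circ> chart_inv c))"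

text \<open>The real differential at \<open>y\<close> of a map to a vector space, on a tangent vector given by its
  coordinates in the chart \<open>c\<close>.\<close>

definition chart_deriv ::
    "('y, 'n::finite) chart \<Rightarrow> ('y \<Rightarrow> 'b::real_normed_vector) \<Rightarrow> 'y \<Rightarrow> complex^'n \<Rightarrow> 'b" where
  "chart_deriv c f y = frechet_derivative (f \<circ> chart_inv c) (at (snd c y))"


section \<open>Hybrid LG models\<close>

text \<open>For \<open>I \<subseteq> {1..N}\<close> (the index set is the type \<open>'N\<close>) the space \<open>\<complex>\<^sup>I\<close> is identified with the
  subspace of \<open>\<complex>\<^sup>N\<close> on which the coordinates outside \<open>I\<close> vanish; \<open>h\<^sub>I\<close> is \<open>coord_proj I \<circ> h\<close>.\<close>

definition coord_proj :: "'N set \<Rightarrow> complex^'N \<Rightarrow> complex^'N" where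
  "coord_proj I z = (\<chi> i. if i \<in> I then z $ i else 0)"

definition base_region :: "real \<Rightarrow> 'N set \<Rightarrow> (complex^'N) set" where
  "base_region R I = {z. (\<forall>i\<in>I. R < norm (z $ i)) \<and> (\<forall>i. i \<notin> I \<longrightarrow> z $ i = 0)}"

text \<open>Over \<open>{y. h\<^sub>I y \<in> base_region R I}\<close> the map \<open>h\<^sub>I\<close> is a submersion.\<close>

definition smooth_fibres ::
    "('y, 'n::finite) chart set \<Rightarrow> ('y \<Rightarrow> complex^'N::finite) \<Rightarrow> real \<Rightarrow> 'N set \<Rightarrow> bool" where
  "smooth_fibres A h R I \<longleftrightarrow>
     (\<forall>c\<in>A. \<forall>y\<in>fst c. coord_proj I (h y) \<in> base_region R I \<longrightarrow>
        (\<forall>w. \<exists>v. chart_deriv c (coord_proj I \<circ> h) y v = coord_proj I w))"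

text \<open>A trivialization over \<open>V\<close> is a map \<open>y \<mapsto> (h\<^sub>I y, \<rho> y)\<close> to the product of \<open>V\<close> with a fibre.
  A tangent vector is horizontal for it if it is tangent to the slice \<open>V \<times> {pt}\<close>, i.e. killed
  by the differential of \<open>\<rho>\<close>.\<close>

definition horizontal ::
    "('y, 'n::finite) chart set \<Rightarrow> ('y \<Rightarrow> 'y) \<Rightarrow> ('y, 'n) chart \<Rightarrow> 'y \<Rightarrow> complex^'n \<Rightarrow> bool" where
  "horizontal A \<rho> c y v \<longleftrightarrow>
     (\<forall>c'\<in>A. \<rho> y \<in> fst c' \<longrightarrow> chart_deriv c (snd c' \<circ> \<rho>) y v = 0)"

text \<open>Source and target of the trivialization have the same dimension, so a smooth bijection with
  injective differential is a diffeomorphism.\<close>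

definition local_trivialization ::
    "('y::topological_space, 'n::finite) chart set \<Rightarrow> ('y \<Rightarrow> complex^'N::finite) \<Rightarrow> real \<Rightarrow> 'N set \<Rightarrow>
       complex^'N \<Rightarrow> (complex^'N) set \<Rightarrow> ('y \<Rightarrow> 'y) \<Rightarrow> bool" where
  "local_trivialization A h R I b V \<rho> \<longleftrightarrow>
     (let h\<^sub>I = coord_proj I \<circ> h in
        b \<in> V \<and> openin (top_of_set (base_region R I)) V \<and>
        smooth_self_map_on A (h\<^sub>I -` V) \<rho> \<and>
        bij_betw (\<lambda>y. (h\<^sub>I y, \<rho> y)) (h\<^sub>I -` V) (V \<times> h\<^sub>I -` {b}) \<and>
        (\<forall>c\<in>A. \<forall>y\<in>fst c \<inter> h\<^sub>I -` V. \<forall>v.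
           chart_deriv c h\<^sub>I y v = 0 \<and> horizontal A \<rho> c y v \<longrightarrow> v = 0))"

text \<open>\<open>V I b\<close> and \<open>\<rho> I b\<close> form the local trivialization of \<open>h\<^sub>I\<close> near \<open>b\<close>. Compatibility for
  \<open>I \<subset> J\<close>: over \<open>B\<^sub>J\<close>, moving only the coordinates in \<open>I\<close> along a slice for \<open>h\<^sub>J\<close> is the same as
  moving along a slice for \<open>h\<^sub>I\<close>. One inclusion between the two spaces of tangent vectors suffices,
  because both have real dimension \<open>2 * card I\<close>.\<close>

definition hybrid_LG_model ::
    "('y::{t2_space,second_countable_topology}, 'n::finite) chart set \<Rightarrow> ('y, 'n) two_form \<Rightarrow>
       ('y \<Rightarrow> complex^'N::finite) \<Rightarrow> bool" where
  "hybrid_LG_model A \<omega> h \<longleftrightarrow>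
     complex_manifold A \<and> kahler_form A \<omega> \<and> calabi_yau A \<and>
     holo_map_from A h \<and> proper_map euclidean euclidean h \<and> surj h \<and>
     (\<exists>R>0. \<exists>V \<rho>.
        (\<forall>I. I \<noteq> {} \<longrightarrow>
           smooth_fibres A h R I \<and>
           (\<forall>b\<in>base_region R I.
              local_trivialization A h R I b (V I b) (\<rho> I b) \<and>
              (\<forall>c\<in>A. \<forall>y\<in>fst c. \<forall>v. coord_proj I (h y) \<in> V I b \<and> horizontal A (\<rho> I b) c y v \<longrightarrow>
                 (\<forall>j. j \<notin> I \<longrightarrow> chart_deriv c (\<lambda>y. h y $ j) y v = 0)))) \<and>
        (\<forall>I J. I \<noteq> {} \<and> I \<subset> J \<longrightarrow>
           (\<forall>b\<in>base_region R J. \<forall>c\<in>A. \<forall>y\<in>fst c. \<forall>v.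
              coord_proj I (h y) \<in> V I (coord_proj I b) \<and> coord_proj J (h y) \<in> V J b \<and>
              horizontal A (\<rho> J b) c y v \<and>
              (\<forall>j\<in>J - I. chart_deriv c (\<lambda>y. h y $ j) y v = 0) \<longrightarrow>
              horizontal A (\<rho> I (coord_proj I b)) c y v)))"


section \<open>Singular cohomology with complex coefficients and the cup product\<close>

type_synonym 'a cochain = "((nat \<Rightarrow> real) \<Rightarrow> 'a) \<Rightarrow> complex"

definition cochains :: "nat \<Rightarrow> 'a topology \<Rightarrow> 'a cochain set" where
  "cochains p Y = {\<phi>. \<forall>s. \<not> singular_simplex p Y s \<longrightarrow> \<phi> s = 0}"

definition coboundary :: "nat \<Rightarrow> 'a topology \<Rightarrow> 'a cochain \<Rightarrow> 'a cochain" where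
  "coboundary p Y \<phi> = (\<lambda>s. if singular_simplex (Suc p) Y s
     then \<Sum>i\<le>Suc p. (-1) ^ i * \<phi> (singular_face (Suc p) i s) else 0)"

definition cocycles :: "nat \<Rightarrow> 'a topology \<Rightarrow> 'a cochain set" where
  "cocycles p Y = {\<phi> \<in> cochains p Y. coboundary p Y \<phi> = (\<lambda>_. 0)}"

definition coboundaries :: "nat \<Rightarrow> 'a topology \<Rightarrow> 'a cochain set" where
  "coboundaries p Y = (case p of 0 \<Rightarrow> {\<lambda>_. 0} | Suc q \<Rightarrow> coboundary q Y ` cochains q Y)"

definition cohomology_class :: "nat \<Rightarrow> 'a topology \<Rightarrow> 'a cochain \<Rightarrow> 'a cochain set" where
  "cohomology_class p Y \<phi> = {\<psi> \<in> cocycles p Y. (\<lambda>s. \<psi> s - \<phi> s) \<in> coboundaries p Y}"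

definition singular_cohomology :: "nat \<Rightarrow> 'a topology \<Rightarrow> 'a cochain set set" where
  "singular_cohomology p Y = cohomology_class p Y ` cocycles p Y"

definition front_face :: "nat \<Rightarrow> ((nat \<Rightarrow> real) \<Rightarrow> 'a) \<Rightarrow> (nat \<Rightarrow> real) \<Rightarrow> 'a" where
  "front_face p s = restrict s (standard_simplex p)"

definition back_face :: "nat \<Rightarrow> nat \<Rightarrow> ((nat \<Rightarrow> real) \<Rightarrow> 'a) \<Rightarrow> (nat \<Rightarrow> real) \<Rightarrow> 'a" where
  "back_face p q s =
     restrict (s \<circ> (\<lambda>x i. if i < p then 0 else x (i - p))) (standard_simplex q)"

definition cup_cochain ::
    "nat \<Rightarrow> nat \<Rightarrow> 'a topology \<Rightarrow> 'a cochain \<Rightarrow> 'a cochain \<Rightarrow> 'a cochain" where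
  "cup_cochain p q Y \<phi> \<psi> = (\<lambda>s. if singular_simplex (p + q) Y s
     then \<phi> (front_face p s) * \<psi> (back_face p q s) else 0)"

text \<open>Operations on classes are defined as unions over representatives; all members of these unions
  coincide.\<close>

definition cup ::
    "nat \<Rightarrow> nat \<Rightarrow> 'a topology \<Rightarrow> 'a cochain set \<Rightarrow> 'a cochain set \<Rightarrow> 'a cochain set" where
  "cup p q Y a b = (\<Union>\<phi>\<in>a. \<Union>\<psi>\<in>b. cohomology_class (p + q) Y (cup_cochain p q Y \<phi> \<psi>))"


section \<open>Complexes of sheaves of complex vector spaces\<close>

text \<open>A sheaf has values in modules over the ring \<open>\<complex>\<close>; only its values on open sets matter, and the
  multiplication and unit of the ambient ring record of a module are irrelevant.\<close>

record ('x, 's) sheaf_data =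
  sec :: "'x set \<Rightarrow> (complex, 's) module"
  restr :: "'x set \<Rightarrow> 'x set \<Rightarrow> 's \<Rightarrow> 's"

definition linear_hom :: "(complex, 's) module \<Rightarrow> (complex, 't) module \<Rightarrow> ('s \<Rightarrow> 't) set" where
  "linear_hom M N = {f \<in> carrier M \<rightarrow> carrier N.
     (\<forall>x\<in>carrier M. \<forall>y\<in>carrier M. f (x \<oplus>\<^bsub>M\<^esub> y) = f x \<oplus>\<^bsub>N\<^esub> f y) \<and>
     (\<forall>a. \<forall>x\<in>carrier M. f (a \<odot>\<^bsub>M\<^esub> x) = a \<odot>\<^bsub>N\<^esub> f x)}"

definition presheaf :: "('x::topological_space, 's) sheaf_data \<Rightarrow> bool" where
  "presheaf F \<longleftrightarrow>
     (\<forall>U. open U \<longrightarrow> Module.module ring_of_type_algebra (sec F U)) \<and>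
     (\<forall>U V. open U \<and> open V \<and> V \<subseteq> U \<longrightarrow> restr F U V \<in> linear_hom (sec F U) (sec F V)) \<and>
     (\<forall>U. open U \<longrightarrow> (\<forall>s\<in>carrier (sec F U). restr F U U s = s)) \<and>
     (\<forall>U V W. open U \<and> open V \<and> open W \<and> W \<subseteq> V \<and> V \<subseteq> U \<longrightarrow>
        (\<forall>s\<in>carrier (sec F U). restr F V W (restr F U V s) = restr F U W s))"

definition sheaf :: "('x::topological_space, 's) sheaf_data \<Rightarrow> bool" where
  "sheaf F \<longleftrightarrow> presheaf F \<and>
     (\<forall>\<U> s. (\<forall>U\<in>\<U>. open U \<and> s U \<in> carrier (sec F U)) \<and>
        (\<forall>U\<in>\<U>. \<forall>V\<in>\<U>. restr F U (U \<inter> V) (s U) = restr F V (U \<inter> V) (s V)) \<longrightarrow>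
        (\<exists>!t. t \<in> carrier (sec F (\<Union>\<U>)) \<and> (\<forall>U\<in>\<U>. restr F (\<Union>\<U>) U t = s U)))"

definition flabby :: "('x::topological_space, 's) sheaf_data \<Rightarrow> bool" where
  "flabby F \<longleftrightarrow> (\<forall>U. open U \<longrightarrow> restr F UNIV U ` carrier (sec F UNIV) = carrier (sec F U))"

definition sheaf_hom ::
    "('x::topological_space, 's) sheaf_data \<Rightarrow> ('x, 't) sheaf_data \<Rightarrow> ('x set \<Rightarrow> 's \<Rightarrow> 't) set" where
  "sheaf_hom F G = {f.
     (\<forall>U. open U \<longrightarrow> f U \<in> linear_hom (sec F U) (sec G U)) \<and>
     (\<forall>U V. open U \<and> open V \<and> V \<subseteq> U \<longrightarrow>
        (\<forall>s\<in>carrier (sec F U). restr G U V (f U s) = f V (restr F U V s)))}"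

record ('x, 's) sheaf_complex =
  obj :: "int \<Rightarrow> ('x, 's) sheaf_data"
  dif :: "int \<Rightarrow> 'x set \<Rightarrow> 's \<Rightarrow> 's"

abbreviation csec :: "('x, 's) sheaf_complex \<Rightarrow> int \<Rightarrow> 'x set \<Rightarrow> (complex, 's) module" where
  "csec K j U \<equiv> sec (obj K j) U"

text \<open>Bounded below complexes of flabby sheaves: they compute hypercohomology by their global
  sections, and their homotopy category localized at quasi-isomorphisms is the bounded below derived
  category.\<close>

definition flabby_complex :: "('x::topological_space, 's) sheaf_complex \<Rightarrow> bool" where
  "flabby_complex K \<longleftrightarrow>
     (\<forall>j. sheaf (obj K j) \<and> flabby (obj K j)) \<and>
     (\<forall>j. dif K j \<in> sheaf_hom (obj K j) (obj K (j + 1))) \<and>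
     (\<forall>j U. open U \<longrightarrow> (\<forall>s\<in>carrier (csec K j U). dif K (j + 1) U (dif K j U s) = \<zero>\<^bsub>csec K (j + 2) U\<^esub>)) \<and>
     (\<exists>m. \<forall>j<m. \<forall>U. open U \<longrightarrow> carrier (csec K j U) = {\<zero>\<^bsub>csec K j U\<^esub>})"

definition complex_hom ::
    "('x::topological_space, 's) sheaf_complex \<Rightarrow> ('x, 't) sheaf_complex \<Rightarrow>
       (int \<Rightarrow> 'x set \<Rightarrow> 's \<Rightarrow> 't) set" where
  "complex_hom K L = {f.
     (\<forall>j. f j \<in> sheaf_hom (obj K j) (obj L j)) \<and>
     (\<forall>j U. open U \<longrightarrow> (\<forall>s\<in>carrier (csec K j U). dif L j U (f j U s) = f (j + 1) U (dif K j U s)))}"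

definition comp_hom ::
    "(int \<Rightarrow> 'x set \<Rightarrow> 't \<Rightarrow> 'u) \<Rightarrow> (int \<Rightarrow> 'x set \<Rightarrow> 's \<Rightarrow> 't) \<Rightarrow> int \<Rightarrow> 'x set \<Rightarrow> 's \<Rightarrow> 'u" where
  "comp_hom g f j U = g j U \<circ> f j U"

definition homotopic_homs ::
    "('x::topological_space, 's) sheaf_complex \<Rightarrow> ('x, 't) sheaf_complex \<Rightarrow>
       (int \<Rightarrow> 'x set \<Rightarrow> 's \<Rightarrow> 't) \<Rightarrow> (int \<Rightarrow> 'x set \<Rightarrow> 's \<Rightarrow> 't) \<Rightarrow> bool" where
  "homotopic_homs K L f g \<longleftrightarrow>
     (\<exists>H. (\<forall>j. H j \<in> sheaf_hom (obj K j) (obj L (j - 1))) \<and>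
        (\<forall>j U. open U \<longrightarrow> (\<forall>s\<in>carrier (csec K j U).
           f j U s = g j U s \<oplus>\<^bsub>csec L j U\<^esub>
             (dif L (j - 1) U (H j U s) \<oplus>\<^bsub>csec L j U\<^esub> H (j + 1) U (dif K j U s)))))"

definition cycle_sections :: "('x, 's) sheaf_complex \<Rightarrow> int \<Rightarrow> 'x set \<Rightarrow> 's set" where
  "cycle_sections K j U = {s \<in> carrier (csec K j U). dif K j U s = \<zero>\<^bsub>csec K (j + 1) U\<^esub>}"

text \<open>Isomorphism on all stalks of all cohomology sheaves.\<close>

definition quasi_iso ::
    "('x::topological_space, 's) sheaf_complex \<Rightarrow> ('x, 't) sheaf_complex \<Rightarrow>
       (int \<Rightarrow> 'x set \<Rightarrow> 's \<Rightarrow> 't) \<Rightarrow> bool" where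
  "quasi_iso K L f \<longleftrightarrow> f \<in> complex_hom K L \<and>
     (\<forall>j U x. open U \<and> x \<in> U \<longrightarrow>
        (\<forall>s\<in>cycle_sections K j U. f j U s \<in> dif L (j - 1) U ` carrier (csec L (j - 1) U) \<longrightarrow>
           (\<exists>V. open V \<and> x \<in> V \<and> V \<subseteq> U \<and>
              restr (obj K j) U V s \<in> dif K (j - 1) V ` carrier (csec K (j - 1) V))) \<and>
        (\<forall>t\<in>cycle_sections L j U. \<exists>V. open V \<and> x \<in> V \<and> V \<subseteq> U \<and>
           (\<exists>s\<in>cycle_sections K j V. \<exists>e\<in>carrier (csec L (j - 1) V).
              restr (obj L j) U V t = f j V s \<oplus>\<^bsub>csec L j V\<^esub> dif L (j - 1) V e)))"


section \<open>Analytic sets and constructible complexes\<close>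

definition analytic_subset :: "(complex^'n::finite) set \<Rightarrow> bool" where
  "analytic_subset Z \<longleftrightarrow> closed Z \<and>
     (\<forall>x\<in>Z. \<exists>U \<F>. open U \<and> x \<in> U \<and> finite \<F> \<and> (\<forall>f\<in>\<F>. holo_fun_on U f) \<and>
        Z \<inter> U = {z \<in> U. \<forall>f\<in>\<F>. f z = 0})"

definition complex_submanifold :: "(complex^'n::finite) set \<Rightarrow> nat \<Rightarrow> bool" where
  "complex_submanifold M e \<longleftrightarrow>
     (\<forall>x\<in>M. \<exists>U W (f :: complex^'n \<Rightarrow> complex^'n) g I. open U \<and> open W \<and> x \<in> U \<and> homeomorphism U W f g \<and>
        holo_map_on U f \<and> holo_map_on W g \<and> card I = e \<and>
        f ` (M \<inter> U) = {w \<in> W. \<forall>i. i \<notin> I \<longrightarrow> w $ i = 0})"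

text \<open>The dimension of an analytic set is the maximal dimension of a nonempty submanifold contained
  in it; the empty set has dimension \<open>- \<infinity>\<close>.\<close>

definition cdim_le :: "(complex^'n::finite) set \<Rightarrow> int \<Rightarrow> bool" where
  "cdim_le Z d \<longleftrightarrow> (\<forall>M e. M \<subseteq> Z \<and> M \<noteq> {} \<and> complex_submanifold M e \<longrightarrow> int e \<le> d)"

definition cohomology_stalk_zero ::
    "('x::topological_space, 's) sheaf_complex \<Rightarrow> int \<Rightarrow> 'x \<Rightarrow> bool" where
  "cohomology_stalk_zero K j x \<longleftrightarrow>
     (\<forall>U. open U \<and> x \<in> U \<longrightarrow> (\<forall>s\<in>cycle_sections K j U.
        \<exists>V. open V \<and> x \<in> V \<and> V \<subseteq> U \<and>
          restr (obj K j) U V s \<in> dif K (j - 1) V ` carrier (csec K (j - 1) V)))"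

definition cohomology_support ::
    "('x::topological_space, 's) sheaf_complex \<Rightarrow> int \<Rightarrow> 'x set" where
  "cohomology_support K j = closure {x. \<not> cohomology_stalk_zero K j x}"

text \<open>The restriction to \<open>S\<close> of the \<open>j\<close>-th cohomology sheaf of \<open>K\<close> is a local system of finite rank:
  near each point of \<open>S\<close> there are finitely many cycles \<open>s 0, \<dots>, s (r - 1)\<close> whose germs form a
  basis of the stalk of the cohomology sheaf at every nearby point of \<open>S\<close>.\<close>

definition locally_constant_along ::
    "('x::topological_space, 's) sheaf_complex \<Rightarrow> int \<Rightarrow> 'x set \<Rightarrow> bool" where
  "locally_constant_along K j S \<longleftrightarrow>
     (\<forall>x\<in>S. \<exists>U (r::nat) s. open U \<and> x \<in> U \<and> (\<forall>i<r. s i \<in> cycle_sections K j U) \<and>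
        (\<forall>y\<in>S \<inter> U. \<forall>W. open W \<and> y \<in> W \<longrightarrow> (\<forall>t\<in>cycle_sections K j W.
           \<exists>!a::nat \<Rightarrow> complex. (\<forall>i\<ge>r. a i = 0) \<and>
             (\<exists>V. open V \<and> y \<in> V \<and> V \<subseteq> U \<inter> W \<and>
                (\<exists>e\<in>carrier (csec K (j - 1) V).
                   restr (obj K j) W V t =
                     finsum (csec K j V) (\<lambda>i. a i \<odot>\<^bsub>csec K j V\<^esub> restr (obj K j) U V (s i)) {..<r}
                     \<oplus>\<^bsub>csec K j V\<^esub> dif K (j - 1) V e)))))"

text \<open>Bounded cohomology, locally constant of finite rank along a locally finite stratification by
  locally closed analytic sets.\<close>

definition constructible :: "(complex^'N::finite, 's) sheaf_complex \<Rightarrow> bool" where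
  "constructible K \<longleftrightarrow>
     (\<exists>m. \<forall>j. m < \<bar>j\<bar> \<longrightarrow> (\<forall>x. cohomology_stalk_zero K j x)) \<and>
     (\<exists>\<S>. \<Union>\<S> = UNIV \<and> pairwise disjnt \<S> \<and>
        (\<forall>x. \<exists>U. open U \<and> x \<in> U \<and> finite {S \<in> \<S>. S \<inter> U \<noteq> {}}) \<and>
        (\<forall>S\<in>\<S>. analytic_subset (closure S) \<and> analytic_subset (closure S - S) \<and>
           (\<forall>j. locally_constant_along K j S)))"


section \<open>The middle perverse t-structure\<close>

text \<open>Flabby models of the constructible objects that are in \<open>\<^sup>pD\<^sup>\<le>\<^sup>l = \<^sup>pD\<^sup>\<le>\<^sup>0[-l]\<close> for the middle
  perversity.\<close>

definition perverse_le :: "int \<Rightarrow> (complex^'N::finite, 's) sheaf_complex \<Rightarrow> bool" where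
  "perverse_le l K \<longleftrightarrow> flabby_complex K \<and> constructible K \<and>
     (\<forall>j. cdim_le (cohomology_support K j) (l - j))"

text \<open>Complexes are taken with sections in a fixed type of cardinality \<open>2\<^sup>c\<close> (\<open>c\<close> the continuum).
  This is large enough for flabby models of all objects and morphisms needed: the cochain sheaves
  below have at most \<open>2\<^sup>c\<close> sections, and this bound is stable under products over the points of
  \<open>\<complex>\<^sup>N\<close>, hence under Godement resolutions.\<close>

type_synonym universe = "real set"

text \<open>Equality in the derived category of two morphisms of complexes.\<close>

definition derived_eq ::
    "('x::topological_space, universe) sheaf_complex \<Rightarrow> ('x, 't) sheaf_complex \<Rightarrow>
       (int \<Rightarrow> 'x set \<Rightarrow> universe \<Rightarrow> 't) \<Rightarrow> (int \<Rightarrow> 'x set \<Rightarrow> universe \<Rightarrow> 't) \<Rightarrow> bool" where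
  "derived_eq K L f g \<longleftrightarrow>
     (\<exists>(K' :: ('x, universe) sheaf_complex) u. flabby_complex K' \<and> quasi_iso K' K u \<and>
        homotopic_homs K' L (comp_hom f u) (comp_hom g u))"

text \<open>The truncation functor is the right adjoint of the inclusion of \<open>\<^sup>pD\<^sup>\<le>\<^sup>l\<close>, and \<open>(T, t)\<close> is its
  value at \<open>F\<close> with the counit: composition with \<open>t\<close> is a bijection from morphisms \<open>K \<rightarrow> T\<close> to
  morphisms \<open>K \<rightarrow> F\<close> in the derived category for all \<open>K\<close> in \<open>\<^sup>pD\<^sup>\<le>\<^sup>l\<close>. Since \<open>\<^sup>pD\<^sup>\<ge>\<^sup>l\<^sup>+\<^sup>1\<close> is the right
  orthogonal of \<open>\<^sup>pD\<^sup>\<le>\<^sup>l\<close>, this says that the cone of \<open>t\<close> is in \<open>\<^sup>pD\<^sup>\<ge>\<^sup>l\<^sup>+\<^sup>1\<close>. A morphism in the derived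
  category is a roof \<open>K \<leftarrow> K' \<rightarrow> F\<close>, and \<open>K'\<close> is again in \<open>\<^sup>pD\<^sup>\<le>\<^sup>l\<close>; so it is enough to treat
  morphisms of complexes with source \<open>K\<close>.\<close>

definition perverse_truncation ::
    "int \<Rightarrow> (complex^'N::finite, universe) sheaf_complex \<Rightarrow>
       (int \<Rightarrow> (complex^'N) set \<Rightarrow> universe \<Rightarrow> 't) \<Rightarrow> (complex^'N, 't) sheaf_complex \<Rightarrow> bool" where
  "perverse_truncation l T t F \<longleftrightarrow>
     perverse_le l T \<and> t \<in> complex_hom T F \<and>
     (\<forall>(K :: (complex^'N, universe) sheaf_complex). perverse_le l K \<longrightarrow>
        (\<forall>f\<in>complex_hom K F.
           \<exists>(K' :: (complex^'N, universe) sheaf_complex) u. flabby_complex K' \<and> quasi_iso K' K u \<and>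
             (\<exists>g\<in>complex_hom K' T. derived_eq K' F (comp_hom t g) (comp_hom f u))) \<and>
        (\<forall>g\<in>complex_hom K T. \<forall>g'\<in>complex_hom K T.
           derived_eq K F (comp_hom t g) (comp_hom t g') \<longrightarrow> derived_eq K T g g'))"


section \<open>The derived direct image and the perverse Leray filtration\<close>

text \<open>The sheaf of singular \<open>j\<close>-cochains on a manifold has as sections over \<open>U\<close> the singular cochains
  of \<open>U\<close> modulo those that are locally zero. These sheaves are flabby and resolve the constant sheaf
  \<open>\<complex>\<close>, so the direct image of this complex under \<open>h\<close> is a flabby model of \<open>Rh\<^sub>*\<complex>\<close>. The degree is an
  integer; there is nothing in negative degrees.\<close>

definition int_cochains :: "int \<Rightarrow> 'y::topological_space set \<Rightarrow> 'y cochain set" where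
  "int_cochains j U = (if j < 0 then {\<lambda>_. 0} else cochains (nat j) (top_of_set U))"

definition int_coboundary :: "int \<Rightarrow> 'y::topological_space set \<Rightarrow> 'y cochain \<Rightarrow> 'y cochain" where
  "int_coboundary j U \<phi> = (if j < 0 then (\<lambda>_. 0) else coboundary (nat j) (top_of_set U) \<phi>)"

definition locally_zero :: "int \<Rightarrow> 'y::topological_space set \<Rightarrow> 'y cochain \<Rightarrow> bool" where
  "locally_zero j U \<phi> \<longleftrightarrow> (\<forall>y\<in>U. \<exists>W. open W \<and> y \<in> W \<and> W \<subseteq> U \<and>
     (\<forall>s. singular_simplex (nat j) (top_of_set W) s \<longrightarrow> \<phi> s = 0))"

definition cochain_section :: "int \<Rightarrow> 'y::topological_space set \<Rightarrow> 'y cochain \<Rightarrow> 'y cochain set" where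
  "cochain_section j U \<phi> = {\<psi> \<in> int_cochains j U. locally_zero j U (\<lambda>s. \<psi> s - \<phi> s)}"

definition cochain_restrict :: "int \<Rightarrow> 'y::topological_space set \<Rightarrow> 'y cochain \<Rightarrow> 'y cochain" where
  "cochain_restrict j V \<phi> =
     (\<lambda>s. if singular_simplex (nat j) (top_of_set V) s then \<phi> s else 0)"

definition cochain_module ::
    "int \<Rightarrow> 'y::topological_space set \<Rightarrow> (complex, 'y cochain set) module" where
  "cochain_module j U =
     \<lparr> carrier = cochain_section j U ` int_cochains j U,
       monoid.mult = undefined, one = undefined,
       ring.zero = cochain_section j U (\<lambda>_. 0),
       add = (\<lambda>a b. \<Union>\<phi>\<in>a. \<Union>\<psi>\<in>b. cochain_section j U (\<lambda>s. \<phi> s + \<psi> s)),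
       module.smult = (\<lambda>z a. \<Union>\<phi>\<in>a. cochain_section j U (\<lambda>s. z * \<phi> s)) \<rparr>"

definition direct_image_complex ::
    "('y::topological_space \<Rightarrow> 'x) \<Rightarrow> ('x, 'y cochain set) sheaf_complex" where
  "direct_image_complex h =
     \<lparr> obj = (\<lambda>j.
         \<lparr> sec = (\<lambda>V. cochain_module j (h -` V)),
           restr = (\<lambda>V W a. \<Union>\<phi>\<in>a. cochain_section j (h -` W) (cochain_restrict j (h -` W) \<phi>)) \<rparr>),
       dif = (\<lambda>j V a. \<Union>\<phi>\<in>a. cochain_section (j + 1) (h -` V) (int_coboundary j (h -` V) \<phi>)) \<rparr>"

text \<open>The image of \<open>H\<^sup>k(\<complex>\<^sup>N, T) \<rightarrow> H\<^sup>k(\<complex>\<^sup>N, Rh\<^sub>*\<complex>) = H\<^sup>k(Y; \<complex>)\<close> induced by \<open>t\<close>. The identification is the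
  isomorphism on cohomology induced by the map from singular cochains on \<open>Y\<close> to global sections of
  the sheaf of cochains.\<close>

definition hypercohomology_image ::
    "nat \<Rightarrow> ('x, universe) sheaf_complex \<Rightarrow>
       (int \<Rightarrow> 'x set \<Rightarrow> universe \<Rightarrow> 'y::topological_space cochain set) \<Rightarrow> 'y cochain set set" where
  "hypercohomology_image k T t =
     {a \<in> singular_cohomology k euclidean.
        \<exists>\<phi>\<in>a. \<exists>c\<in>cycle_sections T (int k) UNIV.
          t (int k) UNIV c = cochain_section (int k) UNIV \<phi>}"

text \<open>\<open>P l k\<close> is the \<open>l\<close>-th step of the filtration on \<open>H\<^sup>k(Y; \<complex>)\<close>. The truncation is determined up to
  unique isomorphism in the derived category, so this determines \<open>P\<close>.\<close>

definition perverse_Leray_filtration ::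
    "('y::topological_space \<Rightarrow> complex^'N::finite) \<Rightarrow> (int \<Rightarrow> nat \<Rightarrow> 'y cochain set set) \<Rightarrow> bool" where
  "perverse_Leray_filtration h P \<longleftrightarrow>
     (\<forall>l. \<exists>T t. perverse_truncation l T t (direct_image_complex h) \<and>
        (\<forall>k. P l k = hypercohomology_image k T t))"

end

theory Submission
  imports Defs
begin

text \<open>For every class \<open>y\<close> of degree \<open>k\<close>, cup product with a cocycle representing \<open>y\<close> is a morphism
  from \<open>Rh\<^sub>*\<complex>\<close> to \<open>Rh\<^sub>*\<complex>[k]\<close>. Restricted to the truncation \<open>\<^sup>p\<tau>\<^sub>\<le>\<^sub>l Rh\<^sub>*\<complex>\<close> it factors through
  \<open>(\<^sup>p\<tau>\<^sub>\<le>\<^sub>l\<^sub>+\<^sub>k Rh\<^sub>*\<complex>)[k]\<close> by the universal property of the latter, so multiplication by \<open>y\<close> maps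
  \<open>P\<^sub>l H\<^sup>i\<close> to \<open>P\<^sub>l\<^sub>+\<^sub>k H\<^sup>i\<^sup>+\<^sup>k\<close>: the factor with the smaller \<open>a\<close> alone determines the bound. On global
  sections this needs that a quasi-isomorphism of bounded below flabby complexes is onto on
  hypercohomology, which holds because its mapping cone, an acyclic flabby complex, has exact
  sections. The cocycle obtained differs from the cup product by the coboundary of a cochain
  on all of \<open>Y\<close>, so small simplices play no role.\<close>

section \<open>Acyclic flabby complexes\<close>

text \<open>The universal property of the truncation speaks only about the derived category, while
  \<open>hypercohomology_image\<close> asks for an actual cycle of \<open>T\<close> with a
  prescribed section as its image. A factorization through the truncation therefore involves two
  quasi-isomorphisms, one on whose source the map into the truncation is defined and one on whose
  source the homotopy lives. The given cycle has to be lifted through both, although a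
  quasi-isomorphism promises such lifts only near points. The mapping cone turns lifting into
  exactness of a single complex. Its sections have a product type, which is harmless: only the
  complexes compared in the definition of the truncation must take values in
  \<open>universe\<close>. Cup products of cochains commute only up to coboundaries, so letting
  either factor be the multiplier requires multiplication from both sides. Both cases are instances
  of the locale \<open>cochain_operator\<close>, and the factorization argument is carried out once,
  for such operators.\<close>

lemma linear_hom_simps:
  assumes "f \<in> linear_hom M N"
  shows "x \<in> carrier M \<Longrightarrow> f x \<in> carrier N"
    and "x \<in> carrier M \<Longrightarrow> y \<in> carrier M \<Longrightarrow> f (x \<oplus>\<^bsub>M\<^esub> y) = f x \<oplus>\<^bsub>N\<^esub> f y"
    and "x \<in> carrier M \<Longrightarrow> f (a \<odot>\<^bsub>M\<^esub> x) = a \<odot>\<^bsub>N\<^esub> f x"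
  using assms by (auto simp: linear_hom_def)

lemma linear_hom_zero:
  assumes "f \<in> linear_hom M N" "abelian_group M" "abelian_group N"
  shows "f \<zero>\<^bsub>M\<^esub> = \<zero>\<^bsub>N\<^esub>"
proof -
  interpret M: abelian_group M by fact
  interpret N: abelian_group N by fact
  have "f \<zero>\<^bsub>M\<^esub> \<in> carrier N"
    by (intro linear_hom_simps(1)[OF assms(1)] M.zero_closed)
  then show ?thesis
    using linear_hom_simps(2)[OF assms(1) M.zero_closed M.zero_closed] by simp
qed

lemma linear_hom_minus:
  assumes "f \<in> linear_hom M N" "abelian_group M" "abelian_group N" "x \<in> carrier M"
  shows "f (\<ominus>\<^bsub>M\<^esub> x) = \<ominus>\<^bsub>N\<^esub> f x"
proof -
  interpret M: abelian_group M by fact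
  interpret N: abelian_group N by fact
  have "f (\<ominus>\<^bsub>M\<^esub> x) \<oplus>\<^bsub>N\<^esub> f x = f (\<ominus>\<^bsub>M\<^esub> x \<oplus>\<^bsub>M\<^esub> x)" "f x \<in> carrier N" "f (\<ominus>\<^bsub>M\<^esub> x) \<in> carrier N"
    using linear_hom_simps[OF assms(1)] assms(4) by auto
  then show ?thesis
    using linear_hom_zero[OF assms(1-3)] assms(4) by (simp add: N.minus_equality M.l_neg)
qed

lemma sheaf_glue:
  assumes "sheaf F" "\<And>U. U \<in> \<U> \<Longrightarrow> open U \<and> s U \<in> carrier (sec F U)"
    and "\<And>U V. U \<in> \<U> \<Longrightarrow> V \<in> \<U> \<Longrightarrow> restr F U (U \<inter> V) (s U) = restr F V (U \<inter> V) (s V)"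
  obtains t where "t \<in> carrier (sec F (\<Union>\<U>))" "\<And>U. U \<in> \<U> \<Longrightarrow> restr F (\<Union>\<U>) U t = s U"
  using assms unfolding sheaf_def by (metis (no_types, lifting))

text \<open>The restrictions of \<open>t\<close> form a compatible family because restrictions
  compose. Both \<open>t\<close> and \<open>t'\<close> glue it, and the glued section is
  unique.\<close>

lemma sheaf_separated:
  assumes F: "sheaf F" and "\<And>U. U \<in> \<U> \<Longrightarrow> open U"
    and t: "t \<in> carrier (sec F (\<Union>\<U>))" "t' \<in> carrier (sec F (\<Union>\<U>))"
    and eq: "\<And>U. U \<in> \<U> \<Longrightarrow> restr F (\<Union>\<U>) U t = restr F (\<Union>\<U>) U t'"
  shows "t = t'"
proof -
  define s where "s U = restr F (\<Union>\<U>) U t" for U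
  have pre: "presheaf F"
    using F by (simp add: sheaf_def)
  have U: "open (\<Union>\<U>)"
    using assms(2) by auto
  have "\<forall>U\<in>\<U>. open U \<and> s U \<in> carrier (sec F U)"
    using pre U assms(2) t unfolding presheaf_def s_def by (metis Union_upper linear_hom_simps(1))
  moreover have "\<forall>V\<in>\<U>. \<forall>W\<in>\<U>. restr F V (V \<inter> W) (s V) = restr F W (V \<inter> W) (s W)"
  proof (intro ballI)
    fix V W assume VW: "V \<in> \<U>" "W \<in> \<U>"
    have *: "restr F Z (V \<inter> W) (s Z) = restr F (\<Union>\<U>) (V \<inter> W) t" if "Z \<in> \<U>" "V \<inter> W \<subseteq> Z" for Z
      using pre U assms(2) t that VW unfolding presheaf_def s_def by (meson Union_upper open_Int)
    show "restr F V (V \<inter> W) (s V) = restr F W (V \<inter> W) (s W)"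
      using *[of V] *[of W] VW by simp
  qed
  ultimately have "\<exists>!t. t \<in> carrier (sec F (\<Union>\<U>)) \<and> (\<forall>U\<in>\<U>. restr F (\<Union>\<U>) U t = s U)"
    using F[unfolded sheaf_def, THEN conjunct2, rule_format, of \<U> s] by simp
  then show ?thesis
    using t eq unfolding s_def by metis
qed

text \<open>A family in the gluing axiom is indexed by the open sets themselves, so for
  \<open>V = W\<close> it cannot hold both \<open>a\<close> and \<open>b\<close>; in that case the
  overlap condition says \<open>a = b\<close>.\<close>

lemma sheaf_glue2:
  assumes F: "sheaf F" and VW: "open V" "open W"
    and a: "a \<in> carrier (sec F V)" and b: "b \<in> carrier (sec F W)"
    and eq: "restr F V (V \<inter> W) a = restr F W (V \<inter> W) b"
  obtains t where "t \<in> carrier (sec F (V \<union> W))" "restr F (V \<union> W) V t = a" "restr F (V \<union> W) W t = b"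
proof (cases "V = W")
  case True
  then have "a = b" "restr F V V a = a"
    using F a b VW eq by (auto simp: sheaf_def presheaf_def)
  then show ?thesis
    using True a that by auto
next
  case False
  define s where "s Z = (if Z = V then a else b)" for Z
  have "\<And>U. U \<in> {V, W} \<Longrightarrow> open U \<and> s U \<in> carrier (sec F U)"
    using a b VW by (auto simp: s_def)
  moreover have "\<And>Z Y. Z \<in> {V, W} \<Longrightarrow> Y \<in> {V, W} \<Longrightarrow> restr F Z (Z \<inter> Y) (s Z) = restr F Y (Z \<inter> Y) (s Y)"
    using eq False by (auto simp: s_def Int_commute)
  ultimately obtain t where "t \<in> carrier (sec F (\<Union>{V, W}))" "\<And>U. U \<in> {V, W} \<Longrightarrow> restr F (\<Union>{V, W}) U t = s U"
    using sheaf_glue[OF F] by metis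
  then show ?thesis
    using False by (intro that[of t]) (auto simp: s_def)
qed

section \<open>Calculus in a complex of flabby sheaves\<close>

locale flabby_cplx =
  fixes K :: "('x::topological_space, 's) sheaf_complex"
  assumes flabby_complex: "flabby_complex K"
begin

lemma is_sheaf: "sheaf (obj K j)"
  using flabby_complex by (simp add: flabby_complex_def)

lemma is_module: "open U \<Longrightarrow> Module.module ring_of_type_algebra (csec K j U)"
  using is_sheaf by (simp add: sheaf_def presheaf_def)

lemma is_abelian_group: "open U \<Longrightarrow> abelian_group (csec K j U)"
  using is_module by (simp add: Module.module_def)

lemma restr_hom: "open U \<Longrightarrow> open V \<Longrightarrow> V \<subseteq> U \<Longrightarrow> restr (obj K j) U V \<in> linear_hom (csec K j U) (csec K j V)"
  using is_sheaf by (simp add: sheaf_def presheaf_def)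

lemmas restr_simps [simp] = linear_hom_simps[OF restr_hom]

lemma restr_zero [simp]:
  "open U \<Longrightarrow> open V \<Longrightarrow> V \<subseteq> U \<Longrightarrow> restr (obj K j) U V \<zero>\<^bsub>csec K j U\<^esub> = \<zero>\<^bsub>csec K j V\<^esub>"
  by (intro linear_hom_zero restr_hom is_abelian_group)

lemma restr_minus [simp]:
  "open U \<Longrightarrow> open V \<Longrightarrow> V \<subseteq> U \<Longrightarrow> s \<in> carrier (csec K j U) \<Longrightarrow>
   restr (obj K j) U V (\<ominus>\<^bsub>csec K j U\<^esub> s) = \<ominus>\<^bsub>csec K j V\<^esub> restr (obj K j) U V s"
  by (intro linear_hom_minus restr_hom is_abelian_group)

lemma restr_self [simp]: "open U \<Longrightarrow> s \<in> carrier (csec K j U) \<Longrightarrow> restr (obj K j) U U s = s"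
  using is_sheaf by (simp add: sheaf_def presheaf_def)

lemma restr_restr [simp]:
  "open U \<Longrightarrow> open V \<Longrightarrow> open W \<Longrightarrow> W \<subseteq> V \<Longrightarrow> V \<subseteq> U \<Longrightarrow> s \<in> carrier (csec K j U) \<Longrightarrow>
   restr (obj K j) V W (restr (obj K j) U V s) = restr (obj K j) U W s"
  using is_sheaf[of j] unfolding sheaf_def presheaf_def by blast

lemma dif_hom: "open U \<Longrightarrow> dif K j U \<in> linear_hom (csec K j U) (csec K (j + 1) U)"
  using flabby_complex by (simp add: flabby_complex_def sheaf_hom_def)

lemma dif_hom': "open U \<Longrightarrow> dif K (j - 1) U \<in> linear_hom (csec K (j - 1) U) (csec K j U)"
  using dif_hom[of U "j - 1"] by simp

lemmas dif_simps [simp] = linear_hom_simps[OF dif_hom]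
lemmas dif_simps' [simp] = linear_hom_simps[OF dif_hom']

lemma dif_zero [simp]:
  "open U \<Longrightarrow> dif K j U \<zero>\<^bsub>csec K j U\<^esub> = \<zero>\<^bsub>csec K (j + 1) U\<^esub>"
  by (intro linear_hom_zero dif_hom is_abelian_group)

lemma dif_minus [simp]:
  "open U \<Longrightarrow> s \<in> carrier (csec K j U) \<Longrightarrow> dif K j U (\<ominus>\<^bsub>csec K j U\<^esub> s) = \<ominus>\<^bsub>csec K (j + 1) U\<^esub> dif K j U s"
  by (intro linear_hom_minus dif_hom is_abelian_group)

lemma dif_dif [simp]:
  "open U \<Longrightarrow> s \<in> carrier (csec K j U) \<Longrightarrow> dif K (j + 1) U (dif K j U s) = \<zero>\<^bsub>csec K (j + 2) U\<^esub>"
  using flabby_complex by (simp add: flabby_complex_def)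

lemma dif_dif' [simp]:
  "open U \<Longrightarrow> s \<in> carrier (csec K (j - 1) U) \<Longrightarrow> dif K j U (dif K (j - 1) U s) = \<zero>\<^bsub>csec K (j + 1) U\<^esub>"
  using dif_dif[of U s "j - 1"] by (simp add: algebra_simps)

lemma restr_dif:
  "open U \<Longrightarrow> open V \<Longrightarrow> V \<subseteq> U \<Longrightarrow> s \<in> carrier (csec K j U) \<Longrightarrow>
   restr (obj K (j + 1)) U V (dif K j U s) = dif K j V (restr (obj K j) U V s)"
  using flabby_complex by (simp add: flabby_complex_def sheaf_hom_def)

lemma restr_dif':
  "open U \<Longrightarrow> open V \<Longrightarrow> V \<subseteq> U \<Longrightarrow> s \<in> carrier (csec K (j - 1) U) \<Longrightarrow>
   restr (obj K j) U V (dif K (j - 1) U s) = dif K (j - 1) V (restr (obj K (j - 1)) U V s)"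
  using restr_dif[of U V s "j - 1"] by simp

lemma extend:
  assumes "open U" "s \<in> carrier (csec K j U)"
  obtains s' where "s' \<in> carrier (csec K j UNIV)" "restr (obj K j) UNIV U s' = s"
  using flabby_complex assms unfolding flabby_complex_def flabby_def by (metis imageE)

lemma cycle_sectionsD:
  assumes "s \<in> cycle_sections K j U"
  shows "s \<in> carrier (csec K j U)" "dif K j U s = \<zero>\<^bsub>csec K (j + 1) U\<^esub>"
  using assms by (auto simp: cycle_sections_def)

text \<open>A section on \<open>V\<close> with differential \<open>z\<close> is enlarged near a point outside \<open>V\<close>: two solutions
  differ on the overlap by a cycle, which is a boundary there by exactness one degree below and
  hence, \<open>K\<close> being flabby, extends to a global cycle.\<close>

lemma enlarge_primitive:
  assumes exact: "\<And>U. open U \<Longrightarrow> cycle_sections K j U \<subseteq> dif K (j - 1) U ` carrier (csec K (j - 1) U)"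
    and acyclic: "\<And>x. cohomology_stalk_zero K (j + 1) x"
    and U: "open U" "z \<in> cycle_sections K (j + 1) U"
    and V: "open V" "V \<subseteq> U" "w \<in> carrier (csec K j V)" "dif K j V w = restr (obj K (j + 1)) U V z"
    and x: "x \<in> U"
  obtains V' w' where "open V'" "V' \<subseteq> U" "V \<subseteq> V'" "x \<in> V'" "w' \<in> carrier (csec K j V')"
    "dif K j V' w' = restr (obj K (j + 1)) U V' z" "restr (obj K j) V' V w' = w"
proof -
  have z: "z \<in> carrier (csec K (j + 1) U)"
    using U(2) by (rule cycle_sectionsD)
  have "\<exists>W. open W \<and> x \<in> W \<and> W \<subseteq> U \<and> restr (obj K (j + 1)) U W z \<in> dif K (j + 1 - 1) W ` carrier (csec K (j + 1 - 1) W)"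
    using acyclic[of x] U x unfolding cohomology_stalk_zero_def by blast
  then obtain W v where W: "open W" "x \<in> W" "W \<subseteq> U" and v: "v \<in> carrier (csec K j W)"
    and dv: "dif K j W v = restr (obj K (j + 1)) U W z"
    by auto
  let ?I = "V \<inter> W"
  have I: "open ?I" "?I \<subseteq> V" "?I \<subseteq> W" "?I \<subseteq> U"
    using V W by auto
  let ?w = "restr (obj K j) V ?I w" and ?v = "restr (obj K j) W ?I v"
  interpret I: abelian_group "csec K j ?I" using I(1) by (rule is_abelian_group)
  interpret I1: abelian_group "csec K (j + 1) ?I" using I(1) by (rule is_abelian_group)
  have wv: "?w \<in> carrier (csec K j ?I)" "?v \<in> carrier (csec K j ?I)"
    using V W v I by auto
  have "dif K j ?I ?w = dif K j ?I ?v"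
    using V W v dv z I U(1) by (simp flip: restr_dif)
  then have "?w \<oplus>\<^bsub>csec K j ?I\<^esub> \<ominus>\<^bsub>csec K j ?I\<^esub> ?v \<in> cycle_sections K j ?I"
    using wv I by (simp add: cycle_sections_def I1.r_neg)
  then obtain e where e: "e \<in> carrier (csec K (j - 1) ?I)"
    and de: "?w \<oplus>\<^bsub>csec K j ?I\<^esub> \<ominus>\<^bsub>csec K j ?I\<^esub> ?v = dif K (j - 1) ?I e"
    using exact[OF I(1)] by auto
  \<comment> \<open>The primitive \<open>e\<close> is extended and not the cycle: an arbitrary
    extension of a cycle need not be a cycle, but the differential of an extended primitive is one
    everywhere.\<close>
  obtain e' where e': "e' \<in> carrier (csec K (j - 1) UNIV)" "restr (obj K (j - 1)) UNIV ?I e' = e"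
    using extend[OF I(1) e] .
  define c where "c = dif K (j - 1) W (restr (obj K (j - 1)) UNIV W e')"
  have c: "c \<in> carrier (csec K j W)" "dif K j W c = \<zero>\<^bsub>csec K (j + 1) W\<^esub>"
    "restr (obj K j) W ?I c = dif K (j - 1) ?I e"
    using W I e' by (simp_all add: c_def restr_dif')
  interpret W: abelian_group "csec K j W" using W(1) by (rule is_abelian_group)
  interpret W1: abelian_group "csec K (j + 1) W" using W(1) by (rule is_abelian_group)
  define v' where "v' = v \<oplus>\<^bsub>csec K j W\<^esub> c"
  have v': "v' \<in> carrier (csec K j W)" "dif K j W v' = restr (obj K (j + 1)) U W z"
    using v c W U z by (simp_all add: v'_def dv)
  have "restr (obj K j) W ?I v' = ?v \<oplus>\<^bsub>csec K j ?I\<^esub> (?w \<oplus>\<^bsub>csec K j ?I\<^esub> \<ominus>\<^bsub>csec K j ?I\<^esub> ?v)"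
    using v c W I by (simp add: v'_def de)
  also have "\<dots> = ?w"
    using wv by (simp add: I.a_lcomm I.r_neg)
  finally have "restr (obj K j) V ?I w = restr (obj K j) W ?I v'" ..
  then obtain t where t: "t \<in> carrier (csec K j (V \<union> W))"
    "restr (obj K j) (V \<union> W) V t = w" "restr (obj K j) (V \<union> W) W t = v'"
    using sheaf_glue2[OF is_sheaf V(1) W(1) V(3) v'(1)] by metis
  have VW: "open (V \<union> W)" "V \<union> W \<subseteq> U"
    using V W by auto
  have "dif K j (V \<union> W) t = restr (obj K (j + 1)) U (V \<union> W) z"
  proof (rule sheaf_separated[OF is_sheaf, of "{V, W}"])
    fix Z assume "Z \<in> {V, W}"
    then show "restr (obj K (j + 1)) (\<Union>{V, W}) Z (dif K j (V \<union> W) t) =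
        restr (obj K (j + 1)) (\<Union>{V, W}) Z (restr (obj K (j + 1)) U (V \<union> W) z)"
      using t V W VW v' z U by (auto simp: restr_dif)
  qed (use t V W VW z U in auto)
  then show ?thesis
    using that[of "V \<union> W" t] t VW W by auto
qed

text \<open>Zorn's lemma for pairs of an open \<open>V\<close> inside \<open>U\<close> and a
  primitive of \<open>z\<close> over \<open>V\<close>, ordered by extension. Chains are bounded by
  gluing, and \<open>enlarge_primitive\<close> forces a maximal pair to have \<open>V = U\<close>.
  Exactness is assumed over every open set because it is applied on overlaps with neighbourhoods
  that acyclicity supplies.\<close>

lemma exact_step:
  assumes exact: "\<And>U. open U \<Longrightarrow> cycle_sections K j U \<subseteq> dif K (j - 1) U ` carrier (csec K (j - 1) U)"
    and acyclic: "\<And>x. cohomology_stalk_zero K (j + 1) x"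
    and U: "open U"
  shows "cycle_sections K (j + 1) U \<subseteq> dif K j U ` carrier (csec K j U)"
proof
  fix z assume zc: "z \<in> cycle_sections K (j + 1) U"
  then have z: "z \<in> carrier (csec K (j + 1) U)"
    by (rule cycle_sectionsD)
  define A where "A = {(V, w). open V \<and> V \<subseteq> U \<and> w \<in> carrier (csec K j V) \<and>
                          dif K j V w = restr (obj K (j + 1)) U V z}"
  define le where "le a b \<longleftrightarrow> fst a \<subseteq> fst b \<and> restr (obj K j) (fst b) (fst a) (snd b) = snd a" for a b
  have A: "open V" "V \<subseteq> U" "w \<in> carrier (csec K j V)" "dif K j V w = restr (obj K (j + 1)) U V z"
    if "(V, w) \<in> A" for V w
    using that by (auto simp: A_def)
  have "\<exists>m\<in>A. \<forall>a\<in>A. le m a \<longrightarrow> a = m"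
  proof (rule predicate_Zorn)
    have "le a a" if "a \<in> A" for a
      using that by (auto simp: le_def A_def)
    moreover have "le a c" if "a \<in> A" "b \<in> A" "c \<in> A" "le a b" "le b c" for a b c
      using that by (cases a; cases b; cases c) (auto simp: le_def A_def)
    moreover have "a = b" if "a \<in> A" "b \<in> A" "le a b" "le b a" for a b
      using that by (cases a; cases b) (auto simp: le_def A_def)
    ultimately show "partial_order_on A (relation_of le A)"
      by (rule partial_order_on_relation_ofI)
  next
    \<comment> \<open>\<open>C\<close> may be empty. Its upper bound is then a section over the
      empty set, which also shows that \<open>A\<close> is nonempty.\<close>
    fix C assume "C \<in> Chains (relation_of le A)"
    then have C: "C \<subseteq> A" and chain: "\<And>a b. a \<in> C \<Longrightarrow> b \<in> C \<Longrightarrow> le a b \<or> le b a"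
      by (auto simp: Chains_def relation_of_def)
    \<comment> \<open>Two pairs in a chain with the same open set coincide, so the chain is a family
      of sections indexed by its open sets, the form that gluing requires.\<close>
    define s where "s V = (SOME w. (V, w) \<in> C)" for V
    have s: "(V, s V) \<in> C" if "(V, w) \<in> C" for V w
      unfolding s_def using that by (rule someI)
    have s_eq: "w = s V" if "(V, w) \<in> C" for V w
      using chain[OF that s[OF that]] A[of V w] A[of V "s V"] C that s[OF that] by (auto simp: le_def)
    let ?U = "fst ` C"
    have sA: "(V, s V) \<in> A" if "V \<in> ?U" for V
      using that s C by fastforce
    have compat: "restr (obj K j) V (V \<inter> W) (s V) = restr (obj K j) W (V \<inter> W) (s W)"
      if "V \<in> ?U" "W \<in> ?U" for V W
    proof -
      have "(V, s V) \<in> C" "(W, s W) \<in> C"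
        using that s by fastforce+
      from chain[OF this] show ?thesis
      proof
        assume "le (V, s V) (W, s W)"
        then have "V \<subseteq> W" "s V = restr (obj K j) W V (s W)" by (simp_all add: le_def)
        moreover have "V \<inter> W = V" using \<open>V \<subseteq> W\<close> by auto
        ultimately show ?thesis using A[OF sA[OF that(1)]] A[OF sA[OF that(2)]] by simp
      next
        assume "le (W, s W) (V, s V)"
        then have "W \<subseteq> V" "s W = restr (obj K j) V W (s V)" by (simp_all add: le_def)
        moreover have "V \<inter> W = W" using \<open>W \<subseteq> V\<close> by auto
        ultimately show ?thesis using A[OF sA[OF that(1)]] A[OF sA[OF that(2)]] by simp
      qed
    qed
    have opn: "\<And>V. V \<in> ?U \<Longrightarrow> open V \<and> s V \<in> carrier (csec K j V)"
      using A(1,3)[OF sA] by simp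
    obtain t where t: "t \<in> carrier (csec K j (\<Union>?U))" "\<And>V. V \<in> ?U \<Longrightarrow> restr (obj K j) (\<Union>?U) V t = s V"
      using sheaf_glue[OF is_sheaf opn compat] by metis
    have "open (\<Union>?U)"
      using A(1)[OF sA] by (intro open_Union ballI)
    moreover have "\<Union>?U \<subseteq> U"
      using A(2)[OF sA] by (intro Union_least)
    ultimately have UU: "open (\<Union>?U)" "\<Union>?U \<subseteq> U" .
    have "dif K j (\<Union>?U) t = restr (obj K (j + 1)) U (\<Union>?U) z"
    proof (rule sheaf_separated[OF is_sheaf])
      fix V assume V: "V \<in> ?U"
      show "open V" using opn[OF V] ..
      have "restr (obj K (j + 1)) (\<Union>?U) V (dif K j (\<Union>?U) t) = dif K j V (s V)"
        using t(2)[OF V] t(1) UU opn[OF V] V by (subst restr_dif) auto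
      also have "\<dots> = restr (obj K (j + 1)) U V z"
        using A(4)[OF sA[OF V]] .
      also have "\<dots> = restr (obj K (j + 1)) (\<Union>?U) V (restr (obj K (j + 1)) U (\<Union>?U) z)"
        using UU U opn[OF V] V z by (subst restr_restr) auto
      finally show "restr (obj K (j + 1)) (\<Union>?U) V (dif K j (\<Union>?U) t) =
          restr (obj K (j + 1)) (\<Union>?U) V (restr (obj K (j + 1)) U (\<Union>?U) z)" .
    qed (use t UU U z in simp_all)
    then have "(\<Union>?U, t) \<in> A"
      using UU t by (simp add: A_def)
    moreover have "le a (\<Union>?U, t)" if "a \<in> C" for a
      using that t(2)[of "fst a"] s_eq[of "fst a" "snd a"] by (auto simp: le_def)
    ultimately show "\<exists>u\<in>A. \<forall>a\<in>C. le a u"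
      by blast
  qed
  then obtain V w where Vw: "(V, w) \<in> A" and max: "\<And>a. a \<in> A \<Longrightarrow> le (V, w) a \<Longrightarrow> a = (V, w)"
    by auto
  have "U \<subseteq> V"
  proof
    fix x assume "x \<in> U"
    from enlarge_primitive[OF exact acyclic U zc A[OF Vw] this]
    obtain V' w' where "open V'" "V' \<subseteq> U" "V \<subseteq> V'" "x \<in> V'" "w' \<in> carrier (csec K j V')"
      "dif K j V' w' = restr (obj K (j + 1)) U V' z" "restr (obj K j) V' V w' = w" .
    then have "(V', w') = (V, w)"
      by (intro max) (auto simp: A_def le_def)
    with \<open>x \<in> V'\<close> show "x \<in> V" by simp
  qed
  then have "V = U" using A[OF Vw] by blast
  then show "z \<in> dif K j U ` carrier (csec K j U)"
    using A[OF Vw] z U by (metis imageI restr_self)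
qed

text \<open>Induction upwards on the degree: a complex bounded below is trivially exact in low
  degrees, and \<open>exact_step\<close> passes from one degree to the next.\<close>

theorem acyclic_imp_exact:
  assumes acyclic: "\<And>j x. cohomology_stalk_zero K j x" and "open U"
  shows "cycle_sections K j U \<subseteq> dif K (j - 1) U ` carrier (csec K (j - 1) U)"
proof -
  obtain m where m: "\<And>j U. j < m \<Longrightarrow> open U \<Longrightarrow> carrier (csec K j U) = {\<zero>\<^bsub>csec K j U\<^esub>}"
    using flabby_complex unfolding flabby_complex_def by metis
  have trivial: "cycle_sections K j U \<subseteq> dif K (j - 1) U ` carrier (csec K (j - 1) U)" if "j < m" "open U" for j U
    using that m[of j U] m[of "j - 1" U] dif_zero[of U "j - 1"] by (auto simp: cycle_sections_def)
  \<comment> \<open>The induction starts at \<open>m - 1\<close>, the last degree known to vanish;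
    degree \<open>m\<close> may be nonzero and is reached by a step.\<close>
  have "\<forall>U. open U \<longrightarrow> cycle_sections K j U \<subseteq> dif K (j - 1) U ` carrier (csec K (j - 1) U)" if "m - 1 \<le> j" for j
    using that
  proof (induction j rule: int_ge_induct)
    case base
    then show ?case using trivial[of "m - 1"] by simp
  next
    case (step i)
    then show ?case
      using exact_step[of i] acyclic by simp
  qed
  then show ?thesis
    using trivial[of j U] \<open>open U\<close> by (cases "j < m") auto
qed

end

section \<open>Mapping cones\<close>

definition product_module :: "(complex, 's) module \<Rightarrow> (complex, 't) module \<Rightarrow> (complex, 's \<times> 't) module" where
  "product_module M N =
     \<lparr> carrier = carrier M \<times> carrier N,
       monoid.mult = undefined, one = undefined,
       ring.zero = (\<zero>\<^bsub>M\<^esub>, \<zero>\<^bsub>N\<^esub>),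
       add = (\<lambda>(a, b) (a', b'). (a \<oplus>\<^bsub>M\<^esub> a', b \<oplus>\<^bsub>N\<^esub> b')),
       module.smult = (\<lambda>z (a, b). (z \<odot>\<^bsub>M\<^esub> a, z \<odot>\<^bsub>N\<^esub> b)) \<rparr>"

lemma product_module_simps [simp]:
  "carrier (product_module M N) = carrier M \<times> carrier N"
  "\<zero>\<^bsub>product_module M N\<^esub> = (\<zero>\<^bsub>M\<^esub>, \<zero>\<^bsub>N\<^esub>)"
  "(a, b) \<oplus>\<^bsub>product_module M N\<^esub> (a', b') = (a \<oplus>\<^bsub>M\<^esub> a', b \<oplus>\<^bsub>N\<^esub> b')"
  "z \<odot>\<^bsub>product_module M N\<^esub> (a, b) = (z \<odot>\<^bsub>M\<^esub> a, z \<odot>\<^bsub>N\<^esub> b)"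
  by (simp_all add: product_module_def)

lemma module_product_module:
  assumes "Module.module R M" "Module.module R N"
  shows "Module.module R (product_module M N)"
proof -
  interpret M: Module.module R M by fact
  interpret N: Module.module R N by fact
  have "abelian_group (product_module M N)"
  proof (rule abelian_groupI, goal_cases)
    case (6 x)
    then show ?case
      by (intro bexI[of _ "(\<ominus>\<^bsub>M\<^esub> fst x, \<ominus>\<^bsub>N\<^esub> snd x)"]) (auto simp: M.l_neg N.l_neg)
  qed (auto simp: M.a_ac N.a_ac)
  then show ?thesis
    by (intro moduleI M.R.is_cring)
       (auto simp: M.smult_l_distr M.smult_r_distr M.smult_assoc1 N.smult_l_distr N.smult_r_distr N.smult_assoc1)
qed

definition product_sheaf ::
    "('x, 's) sheaf_data \<Rightarrow> ('x, 't) sheaf_data \<Rightarrow> ('x, 's \<times> 't) sheaf_data" where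
  "product_sheaf F G =
     \<lparr> sec = (\<lambda>U. product_module (sec F U) (sec G U)),
       restr = (\<lambda>U V. map_prod (restr F U V) (restr G U V)) \<rparr>"

lemma product_sheaf_simps [simp]:
  "sec (product_sheaf F G) U = product_module (sec F U) (sec G U)"
  "restr (product_sheaf F G) U V = map_prod (restr F U V) (restr G U V)"
  by (simp_all add: product_sheaf_def)

lemma linear_hom_product:
  assumes "f \<in> linear_hom M M'" "g \<in> linear_hom N N'"
  shows "map_prod f g \<in> linear_hom (product_module M N) (product_module M' N')"
  using assms unfolding linear_hom_def by auto

lemma presheaf_product:
  assumes "presheaf F" "presheaf G"
  shows "presheaf (product_sheaf F G)"
  using assms unfolding presheaf_def
  by (auto intro!: module_product_module linear_hom_product)

lemma sheaf_product:
  assumes F: "sheaf F" and G: "sheaf G"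
  shows "sheaf (product_sheaf F G)"
  unfolding sheaf_def
proof (intro conjI allI impI)
  show "presheaf (product_sheaf F G)"
    using F G by (intro presheaf_product) (auto simp: sheaf_def)
next
  fix \<U> and s :: "'a set \<Rightarrow> 'b \<times> 'c"
  assume s: "(\<forall>U\<in>\<U>. open U \<and> s U \<in> carrier (sec (product_sheaf F G) U)) \<and>
      (\<forall>U\<in>\<U>. \<forall>V\<in>\<U>. restr (product_sheaf F G) U (U \<inter> V) (s U) = restr (product_sheaf F G) V (U \<inter> V) (s V))"
  have F1: "open U \<and> fst (s U) \<in> carrier (sec F U)"
    and G1: "open U \<and> snd (s U) \<in> carrier (sec G U)" if "U \<in> \<U>" for U
    using s that by (auto simp: mem_Times_iff)
  have F2: "restr F U (U \<inter> V) (fst (s U)) = restr F V (U \<inter> V) (fst (s V))"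
    and G2: "restr G U (U \<inter> V) (snd (s U)) = restr G V (U \<inter> V) (snd (s V))"
    if "U \<in> \<U>" "V \<in> \<U>" for U V
    using s that by (auto simp: map_prod_def split_beta)
  obtain t where t: "t \<in> carrier (sec F (\<Union>\<U>))" "\<And>U. U \<in> \<U> \<Longrightarrow> restr F (\<Union>\<U>) U t = fst (s U)"
    using sheaf_glue[OF F F1 F2] by metis
  obtain u where u: "u \<in> carrier (sec G (\<Union>\<U>))" "\<And>U. U \<in> \<U> \<Longrightarrow> restr G (\<Union>\<U>) U u = snd (s U)"
    using sheaf_glue[OF G G1 G2] by metis
  show "\<exists>!t. t \<in> carrier (sec (product_sheaf F G) (\<Union>\<U>)) \<and>
      (\<forall>U\<in>\<U>. restr (product_sheaf F G) (\<Union>\<U>) U t = s U)"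
  proof (rule ex1I[of _ "(t, u)"])
    show "(t, u) \<in> carrier (sec (product_sheaf F G) (\<Union>\<U>)) \<and>
        (\<forall>U\<in>\<U>. restr (product_sheaf F G) (\<Union>\<U>) U (t, u) = s U)"
      using t u by simp
  next
    fix v assume v: "v \<in> carrier (sec (product_sheaf F G) (\<Union>\<U>)) \<and>
        (\<forall>U\<in>\<U>. restr (product_sheaf F G) (\<Union>\<U>) U v = s U)"
    obtain v1 v2 where v12: "v = (v1, v2)" by fastforce
    have v': "v1 \<in> carrier (sec F (\<Union>\<U>))" "v2 \<in> carrier (sec G (\<Union>\<U>))"
      "\<And>U. U \<in> \<U> \<Longrightarrow> s U = (restr F (\<Union>\<U>) U v1, restr G (\<Union>\<U>) U v2)"
      using v by (auto simp: v12)
    have "v1 = t"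
      by (rule sheaf_separated[OF F]) (use F1 t v' in auto)
    moreover have "v2 = u"
      by (rule sheaf_separated[OF G]) (use G1 u v' in auto)
    ultimately show "v = (t, u)"
      by (simp add: v12)
  qed
qed

lemma flabby_product: "flabby F \<Longrightarrow> flabby G \<Longrightarrow> flabby (product_sheaf F G)"
  by (simp add: flabby_def map_prod_surj_on)

text \<open>The standard cone: \<open>K\<close> shifted by one, plus \<open>L\<close>. As
  \<open>u\<close> commutes with the differentials without a sign, the minus in the first component
  makes \<open>u (- d a)\<close> cancel \<open>d (u a)\<close>, so that the differential squares to
  zero.\<close>

definition mapping_cone ::
    "('x, 's) sheaf_complex \<Rightarrow> ('x, 't) sheaf_complex \<Rightarrow> (int \<Rightarrow> 'x set \<Rightarrow> 's \<Rightarrow> 't) \<Rightarrow>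
       ('x, 's \<times> 't) sheaf_complex" where
  "mapping_cone K L u =
     \<lparr> obj = (\<lambda>j. product_sheaf (obj K (j + 1)) (obj L j)),
       dif = (\<lambda>j U (a, b). (\<ominus>\<^bsub>csec K (j + 2) U\<^esub> dif K (j + 1) U a,
                            u (j + 1) U a \<oplus>\<^bsub>csec L (j + 1) U\<^esub> dif L j U b)) \<rparr>"

lemma mapping_cone_simps [simp]:
  "obj (mapping_cone K L u) j = product_sheaf (obj K (j + 1)) (obj L j)"
  "dif (mapping_cone K L u) j U (a, b) = (\<ominus>\<^bsub>csec K (j + 2) U\<^esub> dif K (j + 1) U a,
      u (j + 1) U a \<oplus>\<^bsub>csec L (j + 1) U\<^esub> dif L j U b)"
  by (simp_all add: mapping_cone_def)

section \<open>The cone of a morphism of flabby complexes\<close>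

locale cplx_map =
  K: flabby_cplx K + L: flabby_cplx L
  for K :: "('x::topological_space, 's) sheaf_complex" and L :: "('x, 't) sheaf_complex" +
  fixes u
  assumes complex_hom: "u \<in> complex_hom K L"
begin

lemma hom_hom: "open U \<Longrightarrow> u j U \<in> linear_hom (csec K j U) (csec L j U)"
  using complex_hom by (simp add: complex_hom_def sheaf_hom_def)

lemmas hom_simps [simp] = linear_hom_simps[OF hom_hom]

lemma hom_zero [simp]: "open U \<Longrightarrow> u j U \<zero>\<^bsub>csec K j U\<^esub> = \<zero>\<^bsub>csec L j U\<^esub>"
  by (intro linear_hom_zero hom_hom K.is_abelian_group L.is_abelian_group)

lemma hom_minus [simp]:
  "open U \<Longrightarrow> s \<in> carrier (csec K j U) \<Longrightarrow> u j U (\<ominus>\<^bsub>csec K j U\<^esub> s) = \<ominus>\<^bsub>csec L j U\<^esub> u j U s"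
  by (intro linear_hom_minus hom_hom K.is_abelian_group L.is_abelian_group)

lemma hom_restr:
  "open U \<Longrightarrow> open V \<Longrightarrow> V \<subseteq> U \<Longrightarrow> s \<in> carrier (csec K j U) \<Longrightarrow>
   restr (obj L j) U V (u j U s) = u j V (restr (obj K j) U V s)"
  using complex_hom by (simp add: complex_hom_def sheaf_hom_def)

lemma hom_dif:
  "open U \<Longrightarrow> s \<in> carrier (csec K j U) \<Longrightarrow> u (j + 1) U (dif K j U s) = dif L j U (u j U s)"
  using complex_hom by (simp add: complex_hom_def)

lemma hom_dif':
  "open U \<Longrightarrow> s \<in> carrier (csec K (j - 1) U) \<Longrightarrow> u j U (dif K (j - 1) U s) = dif L (j - 1) U (u (j - 1) U s)"
  using hom_dif[of U s "j - 1"] by simp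

lemma cone_dif_hom:
  assumes U: "open U"
  shows "dif (mapping_cone K L u) j U \<in>
     linear_hom (csec (mapping_cone K L u) j U) (csec (mapping_cone K L u) (j + 1) U)"
proof -
  interpret K2: Module.module ring_of_type_algebra "csec K (j + 2) U" by (intro K.is_module U)
  interpret L1: Module.module ring_of_type_algebra "csec L (j + 1) U" by (intro L.is_module U)
  have K: "dif K (j + 1) U \<in> linear_hom (csec K (j + 1) U) (csec K (j + 2) U)"
    using K.dif_hom[OF U, of "j + 1"] by (simp add: add.assoc)
  note dK [simp] = linear_hom_simps[OF K]
  have j: "j + 1 + 1 = j + 2" by simp
  show ?thesis
    unfolding linear_hom_def
  proof (intro CollectI conjI ballI allI)
    show "dif (mapping_cone K L u) j U \<in> carrier (csec (mapping_cone K L u) j U)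
        \<rightarrow> carrier (csec (mapping_cone K L u) (j + 1) U)"
      using U by (auto simp: j)
  next
    fix x y assume "x \<in> carrier (csec (mapping_cone K L u) j U)" "y \<in> carrier (csec (mapping_cone K L u) j U)"
    then obtain a b a' b' where "x = (a, b)" "y = (a', b')"
      "a \<in> carrier (csec K (j + 1) U)" "a' \<in> carrier (csec K (j + 1) U)"
      "b \<in> carrier (csec L j U)" "b' \<in> carrier (csec L j U)"
      by auto
    then show "dif (mapping_cone K L u) j U (x \<oplus>\<^bsub>csec (mapping_cone K L u) j U\<^esub> y) =
        dif (mapping_cone K L u) j U x \<oplus>\<^bsub>csec (mapping_cone K L u) (j + 1) U\<^esub> dif (mapping_cone K L u) j U y"
      using U by (simp add: j K2.minus_add L1.a_ac)
  next
    fix z x assume "x \<in> carrier (csec (mapping_cone K L u) j U)"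
    then obtain a b where "x = (a, b)" "a \<in> carrier (csec K (j + 1) U)" "b \<in> carrier (csec L j U)"
      by auto
    then show "dif (mapping_cone K L u) j U (z \<odot>\<^bsub>csec (mapping_cone K L u) j U\<^esub> x) =
        z \<odot>\<^bsub>csec (mapping_cone K L u) (j + 1) U\<^esub> dif (mapping_cone K L u) j U x"
      using U by (simp add: j K2.smult_r_minus L1.smult_r_distr ring_of_type_algebra_def)
  qed
qed

lemma cone_restr_dif:
  assumes "open U" "open V" "V \<subseteq> U" "s \<in> carrier (csec (mapping_cone K L u) j U)"
  shows "restr (obj (mapping_cone K L u) (j + 1)) U V (dif (mapping_cone K L u) j U s) =
     dif (mapping_cone K L u) j V (restr (obj (mapping_cone K L u) j) U V s)"
proof -
  have j: "j + 1 + 1 = j + 2" by simp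
  note K.restr_dif[of _ _ _ "j + 1", unfolded j, simp] K.dif_simps(1)[of _ _ "j + 1", unfolded j, simp]
  show ?thesis
    using assms by (auto simp: j L.restr_dif hom_restr)
qed

lemma cone_dif_dif:
  assumes "open U" "s \<in> carrier (csec (mapping_cone K L u) j U)"
  shows "dif (mapping_cone K L u) (j + 1) U (dif (mapping_cone K L u) j U s)
     = \<zero>\<^bsub>csec (mapping_cone K L u) (j + 2) U\<^esub>"
proof -
  interpret K3: abelian_group "csec K (j + 3) U" by (intro K.is_abelian_group assms)
  interpret L2: abelian_group "csec L (j + 2) U" by (intro L.is_abelian_group assms)
  have j: "j + 1 + 1 = j + 2" "j + 1 + 2 = j + 3" "j + 2 + 1 = j + 3" by simp_all
  note K.dif_dif[of _ _ "j + 1", unfolded j, simp] K.dif_simps(1)[of _ _ "j + 1", unfolded j, simp]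
    K.dif_minus[of _ _ "j + 2", unfolded j, simp] L.dif_simps(1,2)[of _ _ "j + 1", unfolded j, simp]
  obtain a b where ab: "s = (a, b)" "a \<in> carrier (csec K (j + 1) U)" "b \<in> carrier (csec L j U)"
    using assms by auto
  have "u (j + 2) U (dif K (j + 1) U a) = dif L (j + 1) U (u (j + 1) U a)"
    using hom_dif[of U a "j + 1"] assms ab by (simp add: j)
  then show ?thesis
    using assms ab by (simp add: j L2.l_neg)
qed

lemma flabby_complex_cone: "flabby_complex (mapping_cone K L u)"
  unfolding flabby_complex_def
proof (intro conjI allI impI ballI)
  fix j
  show "sheaf (obj (mapping_cone K L u) j)"
    by (simp add: sheaf_product K.is_sheaf L.is_sheaf)
  show "flabby (obj (mapping_cone K L u) j)"
    using K.flabby_complex L.flabby_complex by (simp add: flabby_product flabby_complex_def)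
  show "dif (mapping_cone K L u) j \<in> sheaf_hom (obj (mapping_cone K L u) j) (obj (mapping_cone K L u) (j + 1))"
    unfolding sheaf_hom_def using cone_dif_hom cone_restr_dif by blast
next
  obtain m where "\<And>j U. j < m \<Longrightarrow> open U \<Longrightarrow> carrier (csec K j U) = {\<zero>\<^bsub>csec K j U\<^esub>}"
    using K.flabby_complex unfolding flabby_complex_def by metis
  moreover obtain m' where "\<And>j U. j < m' \<Longrightarrow> open U \<Longrightarrow> carrier (csec L j U) = {\<zero>\<^bsub>csec L j U\<^esub>}"
    using L.flabby_complex unfolding flabby_complex_def by metis
  \<comment> \<open>The bound for \<open>K\<close> drops by one because the cone in degree
    \<open>j\<close> contains \<open>K\<close> in degree \<open>j + 1\<close>.\<close>
  ultimately show "\<exists>m. \<forall>j<m. \<forall>U. open U \<longrightarrow> carrier (csec (mapping_cone K L u) j U) = {\<zero>\<^bsub>csec (mapping_cone K L u) j U\<^esub>}"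
    by (intro exI[of _ "min (m - 1) m'"]) simp
qed (rule cone_dif_dif)

text \<open>A cycle \<open>(a, b)\<close> satisfies \<open>d a = 0\<close> and
  \<open>u a = - d b\<close>. Injectivity of \<open>u\<close> on stalks in degree
  \<open>j + 1\<close> gives \<open>a = d e\<close> near \<open>x\<close>. Then
  \<open>b + u e\<close> is a cycle, and surjectivity in degree \<open>j\<close> writes it as
  \<open>u s' + d e'\<close> on a smaller neighbourhood. The primitive is
  \<open>(s' - e, e')\<close>.\<close>

lemma cone_acyclic:
  assumes u: "quasi_iso K L u"
  shows "cohomology_stalk_zero (mapping_cone K L u) j x"
  unfolding cohomology_stalk_zero_def
proof (intro allI impI ballI)
  fix U s assume U: "open U \<and> x \<in> U" and s: "s \<in> cycle_sections (mapping_cone K L u) j U"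
  then have oU: "open U" by simp
  have j: "j + 1 + 1 = j + 2" by simp
  note jK = K.dif_simps(1)[of _ _ "j + 1", unfolded j]
  interpret K2: abelian_group "csec K (j + 2) U" by (intro K.is_abelian_group oU)
  interpret L1: abelian_group "csec L (j + 1) U" by (intro L.is_abelian_group oU)
  obtain a b where ab: "s = (a, b)" "a \<in> carrier (csec K (j + 1) U)" "b \<in> carrier (csec L j U)"
    and da: "\<ominus>\<^bsub>csec K (j + 2) U\<^esub> dif K (j + 1) U a = \<zero>\<^bsub>csec K (j + 2) U\<^esub>"
    and ub: "u (j + 1) U a \<oplus>\<^bsub>csec L (j + 1) U\<^esub> dif L j U b = \<zero>\<^bsub>csec L (j + 1) U\<^esub>"
    using s by (auto simp: cycle_sections_def j)
  have "dif K (j + 1) U a = \<zero>\<^bsub>csec K (j + 2) U\<^esub>"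
    using K2.l_neg[OF jK[OF oU ab(2)]] da jK[OF oU ab(2)] by simp
  then have a: "a \<in> cycle_sections K (j + 1) U"
    using ab by (simp add: cycle_sections_def j)
  have "u (j + 1) U a = dif L j U (\<ominus>\<^bsub>csec L j U\<^esub> b)"
    using ub ab oU by (simp add: L1.minus_equality)
  moreover have "\<ominus>\<^bsub>csec L j U\<^esub> b \<in> carrier (csec L j U)"
    using L.is_abelian_group[OF oU] ab by (simp add: abelian_group.a_inv_closed)
  ultimately have "u (j + 1) U a \<in> dif L (j + 1 - 1) U ` carrier (csec L (j + 1 - 1) U)"
    by simp
  then have "\<exists>V. open V \<and> x \<in> V \<and> V \<subseteq> U \<and>
      restr (obj K (j + 1)) U V a \<in> dif K (j + 1 - 1) V ` carrier (csec K (j + 1 - 1) V)"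
    using u U a unfolding quasi_iso_def by blast
  then obtain V e where V: "open V" "x \<in> V" "V \<subseteq> U" and e: "e \<in> carrier (csec K j V)"
    and de: "dif K j V e = restr (obj K (j + 1)) U V a"
    by auto
  interpret LV: abelian_group "csec L j V" by (intro L.is_abelian_group V)
  let ?b = "restr (obj L j) U V b"
  define c where "c = ?b \<oplus>\<^bsub>csec L j V\<^esub> u j V e"
  have b: "?b \<in> carrier (csec L j V)"
    using V oU ab by simp
  have "dif L j V c = dif L j V ?b \<oplus>\<^bsub>csec L (j + 1) V\<^esub> u (j + 1) V (restr (obj K (j + 1)) U V a)"
    using V b e by (simp add: c_def flip: de hom_dif)
  also have "\<dots> = restr (obj L (j + 1)) U V (dif L j U b \<oplus>\<^bsub>csec L (j + 1) U\<^esub> u (j + 1) U a)"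
    using V oU ab by (simp add: L.restr_dif hom_restr)
  also have "\<dots> = \<zero>\<^bsub>csec L (j + 1) V\<^esub>"
    using V oU ab ub by (simp add: L1.a_comm)
  finally have "c \<in> cycle_sections L j V"
    using V b e by (simp add: cycle_sections_def c_def)
  then have "\<exists>W. open W \<and> x \<in> W \<and> W \<subseteq> V \<and> (\<exists>s\<in>cycle_sections K j W. \<exists>e\<in>carrier (csec L (j - 1) W).
      restr (obj L j) V W c = u j W s \<oplus>\<^bsub>csec L j W\<^esub> dif L (j - 1) W e)"
    using u V unfolding quasi_iso_def by blast
  then obtain W s' e' where W: "open W" "x \<in> W" "W \<subseteq> V" and s': "s' \<in> cycle_sections K j W"
    and e': "e' \<in> carrier (csec L (j - 1) W)"
    and c: "restr (obj L j) V W c = u j W s' \<oplus>\<^bsub>csec L j W\<^esub> dif L (j - 1) W e'"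
    by blast
  interpret KW: abelian_group "csec K j W" by (intro K.is_abelian_group W)
  interpret KW1: abelian_group "csec K (j + 1) W" by (intro K.is_abelian_group W)
  interpret LW: abelian_group "csec L j W" by (intro L.is_abelian_group W)
  let ?e = "restr (obj K j) V W e"
  have eW: "?e \<in> carrier (csec K j W)"
    using V W e by simp
  have s'c: "s' \<in> carrier (csec K j W)" "dif K j W s' = \<zero>\<^bsub>csec K (j + 1) W\<^esub>"
    using s' by (rule K.cycle_sectionsD)+
  define p where "p = \<ominus>\<^bsub>csec K j W\<^esub> ?e \<oplus>\<^bsub>csec K j W\<^esub> s'"
  have p: "p \<in> carrier (csec K j W)"
    using eW s'c by (simp add: p_def)
  have daW: "dif K j W ?e = restr (obj K (j + 1)) U W a"
    using V W e oU ab by (simp add: de flip: K.restr_dif)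
  then have "\<ominus>\<^bsub>csec K (j + 1) W\<^esub> dif K j W p = restr (obj K (j + 1)) U W a"
    using W V oU ab eW s'c by (simp add: p_def)
  moreover have "u j W p \<oplus>\<^bsub>csec L j W\<^esub> dif L (j - 1) W e' = restr (obj L j) U W b"
  proof -
    have "u j W p \<oplus>\<^bsub>csec L j W\<^esub> dif L (j - 1) W e'
        = \<ominus>\<^bsub>csec L j W\<^esub> u j W ?e \<oplus>\<^bsub>csec L j W\<^esub> restr (obj L j) V W c"
      using W eW s'c e' by (simp add: p_def c LW.a_assoc)
    also have "restr (obj L j) V W c = u j W ?e \<oplus>\<^bsub>csec L j W\<^esub> restr (obj L j) U W b"
      using V W oU ab b e eW by (simp add: c_def hom_restr LW.a_comm)
    also have "\<ominus>\<^bsub>csec L j W\<^esub> u j W ?e \<oplus>\<^bsub>csec L j W\<^esub> (u j W ?e \<oplus>\<^bsub>csec L j W\<^esub> restr (obj L j) U W b)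
        = restr (obj L j) U W b"
      using V W oU ab eW by (simp add: LW.r_neg1)
    finally show ?thesis .
  qed
  moreover have jj: "j - 1 + 1 = j" "j - 1 + 2 = j + 1" by simp_all
  ultimately have "restr (obj (mapping_cone K L u) j) U W s = dif (mapping_cone K L u) (j - 1) W (p, e')"
    by (simp add: ab jj)
  moreover have "(p, e') \<in> carrier (csec (mapping_cone K L u) (j - 1) W)"
    using p e' by simp
  ultimately have "restr (obj (mapping_cone K L u) j) U W s
      \<in> dif (mapping_cone K L u) (j - 1) W ` carrier (csec (mapping_cone K L u) (j - 1) W)"
    by (rule image_eqI)
  then show "\<exists>V. open V \<and> x \<in> V \<and> V \<subseteq> U \<and> restr (obj (mapping_cone K L u) j) U V s
      \<in> dif (mapping_cone K L u) (j - 1) V ` carrier (csec (mapping_cone K L u) (j - 1) V)"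
    using W V by blast
qed

text \<open>A primitive of the cone cycle \<open>(0, t)\<close> is a pair \<open>(s, e)\<close> with
  \<open>d s = 0\<close> and \<open>u s + d e = t\<close>. The definition of
  \<open>quasi_iso\<close> gives such pairs near each point only; exactness of the cone on sections
  gives one over all of \<open>U\<close>.\<close>

theorem quasi_iso_cycle_lift:
  assumes u: "quasi_iso K L u" and U: "open U" and t: "t \<in> cycle_sections L j U"
  obtains s e where "s \<in> cycle_sections K j U" "e \<in> carrier (csec L (j - 1) U)"
    "t = u j U s \<oplus>\<^bsub>csec L j U\<^esub> dif L (j - 1) U e"
proof -
  interpret C: flabby_cplx "mapping_cone K L u"
    by unfold_locales (rule flabby_complex_cone)
  interpret K1: abelian_group "csec K (j + 1) U" by (intro K.is_abelian_group U)
  interpret K2: abelian_group "csec K (j + 2) U" by (intro K.is_abelian_group U)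
  interpret L1: abelian_group "csec L (j + 1) U" by (intro L.is_abelian_group U)
  have j: "j + 1 + 1 = j + 2" "j - 1 + 1 = j" "j - 1 + 2 = j + 1" by simp_all
  have "dif K (j + 1) U \<zero>\<^bsub>csec K (j + 1) U\<^esub> = \<zero>\<^bsub>csec K (j + 2) U\<^esub>"
    using K.dif_zero[OF U, of "j + 1"] by (simp add: j)
  then have "(\<zero>\<^bsub>csec K (j + 1) U\<^esub>, t) \<in> cycle_sections (mapping_cone K L u) j U"
    using t U by (simp add: cycle_sections_def j)
  then obtain s e where se: "s \<in> carrier (csec K j U)" "e \<in> carrier (csec L (j - 1) U)"
    "\<ominus>\<^bsub>csec K (j + 1) U\<^esub> dif K j U s = \<zero>\<^bsub>csec K (j + 1) U\<^esub>"
    "t = u j U s \<oplus>\<^bsub>csec L j U\<^esub> dif L (j - 1) U e"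
    using C.acyclic_imp_exact[OF cone_acyclic[OF u] U, of j] by (auto simp: j)
  then have "dif K j U s = \<zero>\<^bsub>csec K (j + 1) U\<^esub>"
    using K1.l_neg[OF K.dif_simps(1)[OF U se(1)]] K.dif_simps(1)[OF U se(1)] by simp
  with se show ?thesis
    by (intro that) (auto simp: cycle_sections_def)
qed

end

section \<open>The cup product of singular cochains\<close>

lemma simplical_face_in_simplex:
  "i \<le> Suc n \<Longrightarrow> x \<in> standard_simplex n \<Longrightarrow> simplical_face i x \<in> standard_simplex (Suc n)"
  using simplical_face_in_standard_simplex[of "Suc n" i x] by simp

lemma singular_face_Suc:
  "singular_face (Suc n) i s = restrict (s \<circ> simplical_face i) (standard_simplex n)"
  by (simp add: singular_face_def)

lemma singular_simplex_face:
  "singular_simplex (Suc n) Y s \<Longrightarrow> i \<le> Suc n \<Longrightarrow> singular_simplex n Y (singular_face (Suc n) i s)"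
  using singular_simplex_singular_face[of "Suc n" Y s i] by simp

text \<open>Inserting a zero coordinate at \<open>i\<close> and then one at \<open>j + 1\<close> is
  the same as inserting one at \<open>j\<close> and then one at \<open>i\<close>. Off the standard
  simplex both sides are \<open>undefined\<close>, so they agree as functions.\<close>

lemma singular_face_face:
  assumes "i \<le> j" "j \<le> Suc n"
  shows "singular_face (Suc n) i (singular_face (Suc (Suc n)) (Suc j) s) =
         singular_face (Suc n) j (singular_face (Suc (Suc n)) i s)"
proof (rule ext)
  fix t :: "nat \<Rightarrow> real"
  have eq: "simplical_face (Suc j) (simplical_face i t) = simplical_face i (simplical_face j t)"
    using assms by (auto simp: simplical_face_def fun_eq_iff)
  show "singular_face (Suc n) i (singular_face (Suc (Suc n)) (Suc j) s) t =
         singular_face (Suc n) j (singular_face (Suc (Suc n)) i s) t"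
    using assms by (auto simp: singular_face_Suc eq simplical_face_in_simplex)
qed

text \<open>The map inside \<open>back_face\<close>: the inclusion of the face on the vertices
  \<open>p, ..., p + q\<close>, named so that it can be commuted with
  \<open>simplical_face i\<close>.\<close>

definition shift_coords :: "nat \<Rightarrow> (nat \<Rightarrow> real) \<Rightarrow> nat \<Rightarrow> real" where
  "shift_coords p x = (\<lambda>i. if i < p then 0 else x (i - p))"

lemma back_face_eq: "back_face p q s = restrict (s \<circ> shift_coords p) (standard_simplex q)"
  by (simp add: back_face_def shift_coords_def[abs_def])

lemma shift_coords_in_simplex:
  assumes "x \<in> standard_simplex q"
  shows "shift_coords p x \<in> standard_simplex (p + q)"
proof -
  have "(\<Sum>i\<le>p + q. shift_coords p x i) = (\<Sum>i=p..p + q. x (i - p))"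
    by (rule sum.mono_neutral_cong_right) (auto simp: shift_coords_def)
  also have "\<dots> = (\<Sum>i\<le>q. x i)"
    by (rule sum.reindex_bij_witness[of _ "\<lambda>i. i + p" "\<lambda>i. i - p"]) auto
  finally show ?thesis
    using assms by (auto simp: standard_simplex_def shift_coords_def)
qed

lemma singular_simplex_front_face:
  assumes "singular_simplex (p + q) Y s"
  shows "singular_simplex p Y (front_face p s)"
proof -
  have "continuous_map (subtopology (powertop_real UNIV) (standard_simplex p)) Y s"
    using assms standard_simplex_mono[of p "p + q"]
    by (auto simp: singular_simplex_def intro: continuous_map_from_subtopology_mono)
  then show ?thesis
    by (simp add: singular_simplex_def front_face_def)
qed

lemma singular_simplex_back_face:
  assumes "singular_simplex (p + q) Y s"
  shows "singular_simplex q Y (back_face p q s)"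
proof -
  have "continuous_map (subtopology (powertop_real UNIV) (standard_simplex q))
          (subtopology (powertop_real UNIV) (standard_simplex (p + q))) (shift_coords p)"
  proof (clarsimp simp add: continuous_map_in_subtopology shift_coords_in_simplex continuous_map_componentwise)
    fix i
    have "continuous_map (powertop_real UNIV) euclideanreal (\<lambda>x. if i < p then 0 else x (i - p))"
      by (auto intro: continuous_map_product_projection)
    then show "continuous_map (subtopology (powertop_real UNIV) (standard_simplex q)) euclideanreal
                 (\<lambda>x. shift_coords p x i)"
      by (simp add: shift_coords_def continuous_map_from_subtopology)
  qed
  then have "continuous_map (subtopology (powertop_real UNIV) (standard_simplex q)) Y (s \<circ> shift_coords p)"
    using assms unfolding singular_simplex_def by (blast intro: continuous_map_compose)
  then show ?thesis
    by (simp add: singular_simplex_def back_face_eq)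
qed

text \<open>Deleting a vertex either deletes a vertex of the front or back part, or leaves that part
  alone. The ranges in this and the next three lemmas overlap on purpose: at \<open>p + 1\<close>
  for front faces and at \<open>p\<close> for back faces both descriptions apply, and comparing them
  evaluates the two extra terms of the Leibniz rule.\<close>

lemma front_face_singular_face_le:
  assumes "i \<le> Suc p"
  shows "front_face p (singular_face (Suc (p + q)) i s) = singular_face (Suc p) i (front_face (Suc p) s)"
proof (rule ext)
  fix t :: "nat \<Rightarrow> real"
  show "front_face p (singular_face (Suc (p + q)) i s) t = singular_face (Suc p) i (front_face (Suc p) s) t"
    using assms standard_simplex_mono[of p "p + q"]
    by (auto simp: front_face_def singular_face_Suc simplical_face_in_simplex)
qed

lemma front_face_singular_face_ge:
  assumes "p < i"
  shows "front_face p (singular_face (Suc (p + q)) i s) = front_face p s"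
proof (rule ext)
  fix t :: "nat \<Rightarrow> real"
  have "simplical_face i t = t" if "t \<in> standard_simplex p"
    using that assms by (auto simp: simplical_face_def standard_simplex_def fun_eq_iff)
  then show "front_face p (singular_face (Suc (p + q)) i s) t = front_face p s t"
    using standard_simplex_mono[of p "p + q"]
    by (auto simp: front_face_def singular_face_Suc)
qed

lemma back_face_singular_face_le:
  assumes "i \<le> p"
  shows "back_face p q (singular_face (Suc (p + q)) i s) = back_face (Suc p) q s"
proof (rule ext)
  fix t :: "nat \<Rightarrow> real"
  have "simplical_face i (shift_coords p t) = shift_coords (Suc p) t"
    using assms by (auto simp: simplical_face_def shift_coords_def fun_eq_iff)
  then show "back_face p q (singular_face (Suc (p + q)) i s) t = back_face (Suc p) q s t"
    by (auto simp: back_face_eq singular_face_Suc shift_coords_in_simplex)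
qed

lemma back_face_singular_face_ge:
  assumes "i \<le> Suc q"
  shows "back_face p q (singular_face (Suc (p + q)) (p + i) s)
         = singular_face (Suc q) i (back_face p (Suc q) s)"
proof (rule ext)
  fix t :: "nat \<Rightarrow> real"
  have "simplical_face (p + i) (shift_coords p t) = shift_coords p (simplical_face i t)"
    by (auto simp: simplical_face_def shift_coords_def fun_eq_iff)
  then show "back_face p q (singular_face (Suc (p + q)) (p + i) s) t
         = singular_face (Suc q) i (back_face p (Suc q) s) t"
    using assms
    by (auto simp: back_face_eq singular_face_Suc shift_coords_in_simplex simplical_face_in_simplex)
qed

section \<open>Coboundaries and the Leibniz rule\<close>

lemma cochains_closed [intro]:
  "(\<lambda>_. 0) \<in> cochains p Y"
  "\<phi> \<in> cochains p Y \<Longrightarrow> \<psi> \<in> cochains p Y \<Longrightarrow> (\<lambda>s. \<phi> s + \<psi> s) \<in> cochains p Y"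
  "\<phi> \<in> cochains p Y \<Longrightarrow> \<psi> \<in> cochains p Y \<Longrightarrow> (\<lambda>s. \<phi> s - \<psi> s) \<in> cochains p Y"
  "\<phi> \<in> cochains p Y \<Longrightarrow> (\<lambda>s. z * \<phi> s) \<in> cochains p Y"
  by (auto simp: cochains_def)

lemma coboundary_in_cochains [intro]: "coboundary p Y \<phi> \<in> cochains (Suc p) Y"
  by (simp add: cochains_def coboundary_def)

lemma cup_cochain_in_cochains [intro]: "cup_cochain p q Y \<phi> \<psi> \<in> cochains (p + q) Y"
  by (simp add: cochains_def cup_cochain_def)

lemma coboundary_linear:
  "coboundary p Y (\<lambda>_. 0) = (\<lambda>_. 0)"
  "coboundary p Y (\<lambda>s. \<phi> s + \<psi> s) = (\<lambda>s. coboundary p Y \<phi> s + coboundary p Y \<psi> s)"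
  "coboundary p Y (\<lambda>s. \<phi> s - \<psi> s) = (\<lambda>s. coboundary p Y \<phi> s - coboundary p Y \<psi> s)"
  "coboundary p Y (\<lambda>s. z * \<phi> s) = (\<lambda>s. z * coboundary p Y \<phi> s)"
  by (auto simp: coboundary_def sum.distrib sum_subtractf sum_distrib_left algebra_simps)

text \<open>In the double sum over \<open>(i, j)\<close>, a term with \<open>j < i\<close> is
  matched with the term \<open>(j, i - 1)\<close>: by \<open>singular_face_face\<close> it is the
  same iterated face, with the opposite sign.\<close>

lemma coboundary_coboundary: "coboundary (Suc p) Y (coboundary p Y \<phi>) = (\<lambda>_. 0)"
proof (rule ext)
  fix s
  show "coboundary (Suc p) Y (coboundary p Y \<phi>) s = 0"
  proof (cases "singular_simplex (Suc (Suc p)) Y s")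
    case True
    define T where "T = (\<lambda>(i::nat, j). (-1::complex) ^ (i + j) *
       \<phi> (singular_face (Suc p) j (singular_face (Suc (Suc p)) i s)))"
    have "coboundary (Suc p) Y (coboundary p Y \<phi>) s =
       (\<Sum>i\<le>Suc (Suc p). (-1) ^ i * coboundary p Y \<phi> (singular_face (Suc (Suc p)) i s))"
      unfolding coboundary_def[of "Suc p"] using True by simp
    also have "\<dots> = (\<Sum>i\<le>Suc (Suc p). \<Sum>j\<le>Suc p. T (i, j))"
    proof (rule sum.cong[OF refl])
      fix i assume "i \<in> {..Suc (Suc p)}"
      then have "singular_simplex (Suc p) Y (singular_face (Suc (Suc p)) i s)"
        by (intro singular_simplex_face True) simp
      then show "(-1) ^ i * coboundary p Y \<phi> (singular_face (Suc (Suc p)) i s) = (\<Sum>j\<le>Suc p. T (i, j))"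
        unfolding coboundary_def[of p] T_def
        by (simp only: if_True sum_distrib_left power_add mult.assoc prod.case)
    qed
    also have "\<dots> = sum T ({..Suc (Suc p)} \<times> {..Suc p})"
      by (simp add: sum.cartesian_product del: sum.atMost_Suc)
    also have "\<dots> = sum T {(i, j). j < i \<and> i \<le> Suc (Suc p)} + sum T {(i, j). i \<le> j \<and> j \<le> Suc p}"
    proof -
      have *: "{..Suc (Suc p)} \<times> {..Suc p}
          = {(i, j). j < i \<and> i \<le> Suc (Suc p)} \<union> {(i, j). i \<le> j \<and> j \<le> Suc p}"
        by auto
      have "finite ({(i, j). j < i \<and> i \<le> Suc (Suc p)} \<union> {(i, j). i \<le> j \<and> j \<le> Suc p})"
        unfolding *[symmetric] by blast
      then have "finite {(i, j). j < i \<and> i \<le> Suc (Suc p)}" "finite {(i, j). i \<le> j \<and> j \<le> Suc p}"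
        unfolding finite_Un by blast+
      moreover have "{(i, j). j < i \<and> i \<le> Suc (Suc p)} \<inter> {(i, j). i \<le> j \<and> j \<le> Suc p} = {}"
        by auto
      ultimately show ?thesis
        unfolding * by (rule sum.union_disjoint)
    qed
    also have "sum T {(i, j). j < i \<and> i \<le> Suc (Suc p)} = sum (\<lambda>x. - T x) {(i, j). i \<le> j \<and> j \<le> Suc p}"
    proof (rule sum.reindex_bij_witness[of _ "\<lambda>(i, j). (Suc j, i)" "\<lambda>(i, j). (j, i - 1)"])
      fix x assume "x \<in> {(i, j). j < i \<and> i \<le> Suc (Suc p)}"
      then obtain i j where x: "x = (Suc i, j)" "j \<le> i" "i \<le> Suc p"
        by (cases x; cases "fst x") auto
      then show "- T (case x of (i, j) \<Rightarrow> (j, i - 1)) = T x"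
        using singular_face_face[of j i p s] by (simp add: T_def add.commute)
    qed auto
    finally show ?thesis
      by (simp add: sum_negf)
  qed (simp add: coboundary_def)
qed

text \<open>The term \<open>i = p + 1\<close> of the first summand cancels the term \<open>i = 0\<close> of the second.\<close>

lemma coboundary_cup_cochain:
  "coboundary (p + q) Y (cup_cochain p q Y \<phi> \<psi>) s =
     cup_cochain (Suc p) q Y (coboundary p Y \<phi>) \<psi> s +
     (-1) ^ p * cup_cochain p (Suc q) Y \<phi> (coboundary q Y \<psi>) s"
proof (cases "singular_simplex (Suc (p + q)) Y s")
  case True
  define c where "c = \<phi> (front_face p s) * \<psi> (back_face (Suc p) q s)"
  define a where "a i = (-1) ^ i * \<phi> (singular_face (Suc p) i (front_face (Suc p) s))
                          * \<psi> (back_face (Suc p) q s)" for i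
  define b where "b i = (-1) ^ (p + i) * \<phi> (front_face p s)
                          * \<psi> (singular_face (Suc q) i (back_face p (Suc q) s))" for i
  define L where "L i = (-1) ^ i * cup_cochain p q Y \<phi> \<psi> (singular_face (Suc (p + q)) i s)" for i
  have face: "singular_simplex (p + q) Y (singular_face (Suc (p + q)) i s)" if "i \<le> Suc (p + q)" for i
    using True that by (rule singular_simplex_face)
  have fs: "singular_simplex (Suc p) Y (front_face (Suc p) s)"
    using singular_simplex_front_face[of "Suc p" q Y s] True by simp
  have bs: "singular_simplex (Suc q) Y (back_face p (Suc q) s)"
    using singular_simplex_back_face[of p "Suc q" Y s] True by simp
  have La: "L i = a i" if "i \<le> p" for i
    using that face[of i]
    by (simp add: L_def a_def cup_cochain_def front_face_singular_face_le back_face_singular_face_le)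
  have Lb: "L (p + i) = b i" if "0 < i" "i \<le> Suc q" for i
    using that face[of "p + i"]
    by (simp add: L_def b_def cup_cochain_def front_face_singular_face_ge back_face_singular_face_ge)
  have aS: "a (Suc p) = - ((-1) ^ p * c)"
    using front_face_singular_face_le[of "Suc p" p q s] front_face_singular_face_ge[of p "Suc p" q s]
    by (simp add: a_def c_def)
  have b0: "b 0 = (-1) ^ p * c"
    using back_face_singular_face_le[of p p q s] back_face_singular_face_ge[of 0 q p s]
    by (simp add: b_def c_def)
  have "coboundary (p + q) Y (cup_cochain p q Y \<phi> \<psi>) s = (\<Sum>i\<le>Suc (p + q). L i)"
    unfolding coboundary_def L_def using True by simp
  also have "\<dots> = (\<Sum>i\<le>p. L i) + (\<Sum>i=Suc p..p + Suc q. L i)"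
    using sum.ub_add_nat[of 0 p L "Suc q"] by (simp add: atLeast0AtMost del: sum.atMost_Suc)
  also have "(\<Sum>i\<le>p. L i) = (\<Sum>i\<le>p. a i)"
    by (simp add: La)
  also have "(\<Sum>i=Suc p..p + Suc q. L i) = (\<Sum>i=1..Suc q. L (p + i))"
    by (rule sum.reindex_bij_witness[of _ "\<lambda>i. p + i" "\<lambda>i. i - p"]) auto
  also have "\<dots> = (\<Sum>i=1..Suc q. b i)"
    by (rule sum.cong) (auto simp: Lb)
  also have "(\<Sum>i\<le>p. a i) + (\<Sum>i=1..Suc q. b i) = (\<Sum>i\<le>Suc p. a i) + (\<Sum>i\<le>Suc q. b i)"
    using aS b0 sum.atLeast_Suc_atMost[of 0 "Suc q" b] by (simp add: atLeast0AtMost del: sum.cl_ivl_Suc)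
  also have "(\<Sum>i\<le>Suc p. a i) = cup_cochain (Suc p) q Y (coboundary p Y \<phi>) \<psi> s"
    unfolding cup_cochain_def coboundary_def a_def
    using True fs by (simp add: sum_distrib_right del: sum.atMost_Suc)
  also have "(\<Sum>i\<le>Suc q. b i) = (-1) ^ p * cup_cochain p (Suc q) Y \<phi> (coboundary q Y \<psi>) s"
    unfolding cup_cochain_def coboundary_def b_def
    using True bs by (simp add: sum_distrib_left power_add mult_ac del: sum.atMost_Suc)
  finally show ?thesis .
qed (simp add: coboundary_def cup_cochain_def)

lemma cup_cochain_bilinear:
  "cup_cochain p q Y (\<lambda>_. 0) \<psi> = (\<lambda>_. 0)"
  "cup_cochain p q Y \<phi> (\<lambda>_. 0) = (\<lambda>_. 0)"
  "cup_cochain p q Y (\<lambda>s. \<phi> s + \<phi>' s) \<psi> = (\<lambda>s. cup_cochain p q Y \<phi> \<psi> s + cup_cochain p q Y \<phi>' \<psi> s)"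
  "cup_cochain p q Y \<phi> (\<lambda>s. \<psi> s + \<psi>' s) = (\<lambda>s. cup_cochain p q Y \<phi> \<psi> s + cup_cochain p q Y \<phi> \<psi>' s)"
  "cup_cochain p q Y (\<lambda>s. \<phi> s - \<phi>' s) \<psi> = (\<lambda>s. cup_cochain p q Y \<phi> \<psi> s - cup_cochain p q Y \<phi>' \<psi> s)"
  "cup_cochain p q Y \<phi> (\<lambda>s. \<psi> s - \<psi>' s) = (\<lambda>s. cup_cochain p q Y \<phi> \<psi> s - cup_cochain p q Y \<phi> \<psi>' s)"
  "cup_cochain p q Y (\<lambda>s. z * \<phi> s) \<psi> = (\<lambda>s. z * cup_cochain p q Y \<phi> \<psi> s)"
  "cup_cochain p q Y \<phi> (\<lambda>s. z * \<psi> s) = (\<lambda>s. z * cup_cochain p q Y \<phi> \<psi> s)"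
  by (auto simp: cup_cochain_def algebra_simps)

lemma cup_cochain_cocycle:
  assumes "\<phi> \<in> cocycles p Y" "\<psi> \<in> cocycles q Y"
  shows "cup_cochain p q Y \<phi> \<psi> \<in> cocycles (p + q) Y"
proof -
  have "coboundary p Y \<phi> = (\<lambda>_. 0)" "coboundary q Y \<psi> = (\<lambda>_. 0)"
    using assms by (simp_all add: cocycles_def)
  then have "coboundary (p + q) Y (cup_cochain p q Y \<phi> \<psi>) = (\<lambda>_. 0)"
    by (intro ext) (simp add: coboundary_cup_cochain cup_cochain_bilinear)
  then show ?thesis
    by (auto simp: cocycles_def)
qed

lemma coboundaries_closed:
  "(\<lambda>_. 0) \<in> coboundaries p Y"
  "\<phi> \<in> coboundaries p Y \<Longrightarrow> \<psi> \<in> coboundaries p Y \<Longrightarrow> (\<lambda>s. \<phi> s + \<psi> s) \<in> coboundaries p Y"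
  "\<phi> \<in> coboundaries p Y \<Longrightarrow> (\<lambda>s. z * \<phi> s) \<in> coboundaries p Y"
proof -
  show "(\<lambda>_. 0) \<in> coboundaries p Y"
    by (cases p) (auto simp: coboundaries_def intro!: image_eqI[of _ _ "\<lambda>_. 0"] simp: coboundary_linear)
  show "(\<lambda>s. \<phi> s + \<psi> s) \<in> coboundaries p Y" if "\<phi> \<in> coboundaries p Y" "\<psi> \<in> coboundaries p Y"
    using that by (cases p) (auto simp: coboundaries_def image_iff coboundary_linear(2)[symmetric] intro!: bexI[of _ "\<lambda>s. _ s + _ s"])
  show "(\<lambda>s. z * \<phi> s) \<in> coboundaries p Y" if "\<phi> \<in> coboundaries p Y"
    using that by (cases p) (auto simp: coboundaries_def image_iff coboundary_linear(4)[symmetric] intro!: bexI[of _ "\<lambda>s. z * _ s"])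
qed

lemma coboundaries_subset_cocycles: "coboundaries p Y \<subseteq> cocycles p Y"
  by (cases p) (auto simp: coboundaries_def cocycles_def coboundary_coboundary coboundary_linear)

text \<open>With \<psi> a cocycle, the Leibniz rule makes the product of a coboundary with \<psi>
  the coboundary of a product. Degree 0 is separate, the only coboundary there being zero.\<close>

lemma cup_cochain_coboundary_left:
  assumes "\<phi> \<in> coboundaries p Y" "\<psi> \<in> cocycles q Y"
  shows "cup_cochain p q Y \<phi> \<psi> \<in> coboundaries (p + q) Y"
proof (cases p)
  case 0
  then show ?thesis
    using assms coboundaries_closed(1) by (simp add: coboundaries_def cup_cochain_bilinear)
next
  case (Suc r)
  then obtain \<eta> where "\<eta> \<in> cochains r Y" "\<phi> = coboundary r Y \<eta>"
    using assms by (auto simp: coboundaries_def)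
  moreover have "coboundary q Y \<psi> = (\<lambda>_. 0)"
    using assms by (simp add: cocycles_def)
  ultimately have "cup_cochain p q Y \<phi> \<psi> = coboundary (r + q) Y (cup_cochain r q Y \<eta> \<psi>)"
    by (intro ext) (simp add: Suc coboundary_cup_cochain cup_cochain_bilinear)
  then show ?thesis
    unfolding Suc coboundaries_def by auto
qed

lemma cup_cochain_coboundary_right:
  assumes "\<phi> \<in> cocycles p Y" "\<psi> \<in> coboundaries q Y"
  shows "cup_cochain p q Y \<phi> \<psi> \<in> coboundaries (p + q) Y"
proof (cases q)
  case 0
  then show ?thesis
    using assms coboundaries_closed(1) by (simp add: coboundaries_def cup_cochain_bilinear)
next
  case (Suc r)
  then obtain \<eta> where "\<eta> \<in> cochains r Y" "\<psi> = coboundary r Y \<eta>"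
    using assms by (auto simp: coboundaries_def)
  moreover have "coboundary p Y \<phi> = (\<lambda>_. 0)"
    using assms by (simp add: cocycles_def)
  \<comment> \<open>The sign in front of the primitive cancels the \<open>(-1) ^ p\<close> of the
    Leibniz rule.\<close>
  ultimately have "cup_cochain p q Y \<phi> \<psi>
      = coboundary (p + r) Y (\<lambda>s. (-1) ^ p * cup_cochain p r Y \<phi> \<eta> s)"
    by (intro ext) (simp add: Suc coboundary_linear coboundary_cup_cochain cup_cochain_bilinear
        flip: mult.assoc power_add)
  then show ?thesis
    unfolding Suc coboundaries_def by auto
qed

section \<open>The cup product on cohomology classes\<close>

lemma cohomology_class_eq:
  assumes "(\<lambda>s. \<phi> s - \<psi> s) \<in> coboundaries p Y"
  shows "cohomology_class p Y \<phi> = cohomology_class p Y \<psi>"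
proof -
  have "(\<lambda>s. \<theta> s - \<psi> s) \<in> coboundaries p Y \<longleftrightarrow> (\<lambda>s. \<theta> s - \<phi> s) \<in> coboundaries p Y" for \<theta>
  proof
    assume "(\<lambda>s. \<theta> s - \<psi> s) \<in> coboundaries p Y"
    from coboundaries_closed(2)[OF this coboundaries_closed(3)[OF assms, of "-1"]]
    show "(\<lambda>s. \<theta> s - \<phi> s) \<in> coboundaries p Y" by (simp add: algebra_simps)
  next
    assume "(\<lambda>s. \<theta> s - \<phi> s) \<in> coboundaries p Y"
    from coboundaries_closed(2)[OF this assms]
    show "(\<lambda>s. \<theta> s - \<psi> s) \<in> coboundaries p Y" by simp
  qed
  then show ?thesis
    by (simp add: cohomology_class_def)
qed

lemma singular_cohomology_member:
  assumes "a \<in> singular_cohomology p Y" "\<phi> \<in> a"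
  shows "\<phi> \<in> cocycles p Y" "a = cohomology_class p Y \<phi>"
proof -
  obtain \<psi> where "a = cohomology_class p Y \<psi>"
    using assms by (auto simp: singular_cohomology_def)
  moreover from this assms show "\<phi> \<in> cocycles p Y"
    by (simp add: cohomology_class_def)
  ultimately show "a = cohomology_class p Y \<phi>"
    using assms cohomology_class_eq[of \<phi> \<psi> p Y] by (simp add: cohomology_class_def)
qed

text \<open>Independence of representatives collapses the union in \<open>cup\<close>: the
  difference of two products is
  \<open>(\<phi>' - \<phi>) \<psi> + \<phi>' (\<psi>' - \<psi>)\<close>, a coboundary times a
  cocycle plus a cocycle times a coboundary.\<close>

lemma cup_eq_cohomology_class:
  assumes "a \<in> singular_cohomology p Y" "b \<in> singular_cohomology q Y" "\<phi> \<in> a" "\<psi> \<in> b"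
  shows "cup p q Y a b = cohomology_class (p + q) Y (cup_cochain p q Y \<phi> \<psi>)"
proof -
  have "cohomology_class (p + q) Y (cup_cochain p q Y \<phi>' \<psi>')
      = cohomology_class (p + q) Y (cup_cochain p q Y \<phi> \<psi>)" if "\<phi>' \<in> a" "\<psi>' \<in> b" for \<phi>' \<psi>'
  proof (rule cohomology_class_eq)
    have "(\<lambda>s. \<phi>' s - \<phi> s) \<in> coboundaries p Y" "(\<lambda>s. \<psi>' s - \<psi> s) \<in> coboundaries q Y"
      using singular_cohomology_member[OF assms(1,3)] singular_cohomology_member[OF assms(2,4)] that
      by (auto simp: cohomology_class_def)
    with singular_cohomology_member[OF assms(1) that(1)] singular_cohomology_member[OF assms(2) assms(4)]
    have "cup_cochain p q Y (\<lambda>s. \<phi>' s - \<phi> s) \<psi> \<in> coboundaries (p + q) Y"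
      "cup_cochain p q Y \<phi>' (\<lambda>s. \<psi>' s - \<psi> s) \<in> coboundaries (p + q) Y"
      by (auto intro: cup_cochain_coboundary_left cup_cochain_coboundary_right)
    from coboundaries_closed(2)[OF this]
    show "(\<lambda>s. cup_cochain p q Y \<phi>' \<psi>' s - cup_cochain p q Y \<phi> \<psi> s) \<in> coboundaries (p + q) Y"
      by (simp add: cup_cochain_bilinear)
  qed
  then have "cup p q Y a b
      = (\<Union>_\<in>a. \<Union>_\<in>b. cohomology_class (p + q) Y (cup_cochain p q Y \<phi> \<psi>))"
    unfolding cup_def by (intro SUP_cong refl)
  then show ?thesis
    using assms(3,4) by auto
qed

section \<open>Shifts and sections of the direct image\<close>

text \<open>Usually written \<open>K[-k]\<close>, here without the customary sign
  \<open>(-1) ^ k\<close> on the differential; signs are left to the multiplication maps. The source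
  is shifted down rather than the target up, so that the universal property of a truncation of the
  direct image applies as it stands.\<close>

definition shift_complex :: "int \<Rightarrow> ('x, 's) sheaf_complex \<Rightarrow> ('x, 's) sheaf_complex" where
  "shift_complex k K = \<lparr> obj = (\<lambda>j. obj K (j - k)), dif = (\<lambda>j. dif K (j - k)) \<rparr>"

lemma shift_complex_simps [simp]:
  "obj (shift_complex k K) j = obj K (j - k)"
  "dif (shift_complex k K) j = dif K (j - k)"
  by (simp_all add: shift_complex_def)

text \<open>Keeps \<open>j - k\<close> together as a term, so that a condition on the shifted
  complex turns literally into the condition on \<open>K\<close> in degree
  \<open>j - k\<close>.\<close>

lemma shift_index:
  fixes j k :: int
  shows "j + 1 - k = j - k + 1" "j + 2 - k = j - k + 2" "j - 1 - k = j - k - 1"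
  by simp_all

lemma cycle_sections_shift [simp]: "cycle_sections (shift_complex k K) j U = cycle_sections K (j - k) U"
  by (simp only: cycle_sections_def shift_complex_simps shift_index)

lemma cohomology_stalk_zero_shift [simp]:
  "cohomology_stalk_zero (shift_complex k K) j x = cohomology_stalk_zero K (j - k) x"
  by (simp only: cohomology_stalk_zero_def shift_complex_simps cycle_sections_shift shift_index)

lemma locally_constant_along_shift [simp]:
  "locally_constant_along (shift_complex k K) j S = locally_constant_along K (j - k) S"
  by (simp only: locally_constant_along_def shift_complex_simps cycle_sections_shift shift_index)

lemma flabby_complex_shift:
  assumes "flabby_complex K"
  shows "flabby_complex (shift_complex k K)"
proof -
  obtain m where "\<And>j U. j < m \<Longrightarrow> open U \<Longrightarrow> carrier (csec K j U) = {\<zero>\<^bsub>csec K j U\<^esub>}"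
    using assms unfolding flabby_complex_def by metis
  then have "\<exists>m. \<forall>j<m. \<forall>U. open U \<longrightarrow> carrier (csec (shift_complex k K) j U) = {\<zero>\<^bsub>csec (shift_complex k K) j U\<^esub>}"
    by (intro exI[of _ "m + k"]) simp
  moreover interpret flabby_cplx K
    by unfold_locales (rule assms)
  have "dif K (j - k) \<in> sheaf_hom (obj K (j - k)) (obj K (j - k + 1))" for j
    using assms by (simp add: flabby_complex_def)
  moreover have "flabby (obj K (j - k))" for j
    using assms by (simp add: flabby_complex_def)
  ultimately show ?thesis
    by (simp add: flabby_complex_def shift_index is_sheaf)
qed

lemma constructible_shift:
  assumes "constructible K"
  shows "constructible (shift_complex k K)"
proof -
  obtain m where "\<And>j x. m < \<bar>j\<bar> \<Longrightarrow> cohomology_stalk_zero K j x"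
    using assms unfolding constructible_def by blast
  then have "\<exists>m. \<forall>j. m < \<bar>j\<bar> \<longrightarrow> (\<forall>x. cohomology_stalk_zero (shift_complex k K) j x)"
    by (intro exI[of _ "m + \<bar>k\<bar>"]) simp
  moreover obtain \<S> where "\<Union>\<S> = UNIV \<and> pairwise disjnt \<S> \<and>
        (\<forall>x. \<exists>U. open U \<and> x \<in> U \<and> finite {S \<in> \<S>. S \<inter> U \<noteq> {}}) \<and>
        (\<forall>S\<in>\<S>. analytic_subset (closure S) \<and> analytic_subset (closure S - S) \<and>
           (\<forall>j. locally_constant_along K j S))"
    using assms unfolding constructible_def by blast
  ultimately show ?thesis
    unfolding constructible_def locally_constant_along_shift by blast
qed

text \<open>Degree \<open>j\<close> of the shift is degree \<open>j - k\<close> of \<open>K\<close>,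
  whose support has dimension at most \<open>l - (j - k) = (l + k) - j\<close>. This is the source
  of the rise of the filtration index by the degree of the multiplier.\<close>

lemma perverse_le_shift:
  assumes "perverse_le l K"
  shows "perverse_le (l + k) (shift_complex k K)"
proof -
  have "cdim_le (cohomology_support K (j - k)) (l + k - j)" for j
    using assms[unfolded perverse_le_def] by (metis add_diff_eq diff_diff_eq2)
  then show ?thesis
    using assms
    by (simp add: perverse_le_def flabby_complex_shift constructible_shift cohomology_support_def)
qed

section \<open>Cochains modulo locally zero cochains\<close>

lemma int_cochains_closed [intro]:
  "(\<lambda>_. 0) \<in> int_cochains j U"
  "\<phi> \<in> int_cochains j U \<Longrightarrow> \<psi> \<in> int_cochains j U \<Longrightarrow> (\<lambda>s. \<phi> s + \<psi> s) \<in> int_cochains j U"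
  "\<phi> \<in> int_cochains j U \<Longrightarrow> \<psi> \<in> int_cochains j U \<Longrightarrow> (\<lambda>s. \<phi> s - \<psi> s) \<in> int_cochains j U"
  "\<phi> \<in> int_cochains j U \<Longrightarrow> (\<lambda>s. z * \<phi> s) \<in> int_cochains j U"
  by (auto simp: int_cochains_def)

lemma int_coboundary_in_cochains [intro]: "int_coboundary j U \<phi> \<in> int_cochains (j + 1) U"
  by (auto simp: int_cochains_def int_coboundary_def nat_add_distrib)

lemma int_coboundary_linear:
  "int_coboundary j U (\<lambda>_. 0) = (\<lambda>_. 0)"
  "int_coboundary j U (\<lambda>s. \<phi> s + \<psi> s) = (\<lambda>s. int_coboundary j U \<phi> s + int_coboundary j U \<psi> s)"
  "int_coboundary j U (\<lambda>s. \<phi> s - \<psi> s) = (\<lambda>s. int_coboundary j U \<phi> s - int_coboundary j U \<psi> s)"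
  "int_coboundary j U (\<lambda>s. z * \<phi> s) = (\<lambda>s. z * int_coboundary j U \<phi> s)"
  by (simp_all add: int_coboundary_def coboundary_linear)

lemma singular_simplex_top_of_set_mono:
  "singular_simplex p (top_of_set V) s \<Longrightarrow> V \<subseteq> U \<Longrightarrow> singular_simplex p (top_of_set U) s"
  by (auto simp: singular_simplex_subtopology)

lemma locally_zero_0 [simp]: "locally_zero j U (\<lambda>_. 0)"
  if "open U"
  using that by (auto simp: locally_zero_def)

lemma locally_zero_add:
  assumes "locally_zero j U \<phi>" "locally_zero j U \<psi>"
  shows "locally_zero j U (\<lambda>s. \<phi> s + \<psi> s)"
  unfolding locally_zero_def
proof
  fix y assume "y \<in> U"
  obtain V where V: "open V" "y \<in> V" "V \<subseteq> U" "\<And>s. singular_simplex (nat j) (top_of_set V) s \<Longrightarrow> \<phi> s = 0"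
    using assms(1) \<open>y \<in> U\<close> unfolding locally_zero_def by metis
  obtain W where W: "open W" "y \<in> W" "W \<subseteq> U" "\<And>s. singular_simplex (nat j) (top_of_set W) s \<Longrightarrow> \<psi> s = 0"
    using assms(2) \<open>y \<in> U\<close> unfolding locally_zero_def by metis
  show "\<exists>W. open W \<and> y \<in> W \<and> W \<subseteq> U \<and> (\<forall>s. singular_simplex (nat j) (top_of_set W) s \<longrightarrow> \<phi> s + \<psi> s = 0)"
  proof (intro exI conjI allI impI)
    fix s assume "singular_simplex (nat j) (top_of_set (V \<inter> W)) s"
    then have "singular_simplex (nat j) (top_of_set V) s" "singular_simplex (nat j) (top_of_set W) s"
      by (auto intro: singular_simplex_top_of_set_mono)
    then show "\<phi> s + \<psi> s = 0"
      by (simp add: V W)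
  qed (use V W in auto)
qed

lemma locally_zero_smult: "locally_zero j U \<phi> \<Longrightarrow> locally_zero j U (\<lambda>s. z * \<phi> s)"
  unfolding locally_zero_def by (metis mult_zero_right)

lemma locally_zero_restrict:
  assumes "locally_zero j U \<phi>" "open V" "V \<subseteq> U"
  shows "locally_zero j V (cochain_restrict j V \<phi>)"
  unfolding locally_zero_def
proof
  fix y assume "y \<in> V"
  then obtain W where W: "open W" "y \<in> W" "W \<subseteq> U" "\<And>s. singular_simplex (nat j) (top_of_set W) s \<Longrightarrow> \<phi> s = 0"
    using assms unfolding locally_zero_def by (metis subsetD)
  show "\<exists>W. open W \<and> y \<in> W \<and> W \<subseteq> V \<and>
      (\<forall>s. singular_simplex (nat j) (top_of_set W) s \<longrightarrow> cochain_restrict j V \<phi> s = 0)"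
  proof (intro exI conjI allI impI)
    fix s assume "singular_simplex (nat j) (top_of_set (V \<inter> W)) s"
    then have "singular_simplex (nat j) (top_of_set W) s"
      by (auto intro: singular_simplex_top_of_set_mono)
    then show "cochain_restrict j V \<phi> s = 0"
      by (simp add: W cochain_restrict_def)
  qed (use \<open>y \<in> V\<close> assms W in auto)
qed

lemma locally_zero_coboundary:
  assumes "locally_zero j U \<phi>" "open U"
  shows "locally_zero (j + 1) U (int_coboundary j U \<phi>)"
proof (cases "j < 0")
  case True
  then show ?thesis using assms by (simp add: int_coboundary_def)
next
  case False
  show ?thesis
    unfolding locally_zero_def
  proof
    fix y assume "y \<in> U"
    then obtain W where W: "open W" "y \<in> W" "W \<subseteq> U" "\<And>s. singular_simplex (nat j) (top_of_set W) s \<Longrightarrow> \<phi> s = 0"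
      using assms unfolding locally_zero_def by metis
    have "coboundary (nat j) (top_of_set U) \<phi> s = 0" if "singular_simplex (Suc (nat j)) (top_of_set W) s" for s
      using singular_simplex_face[OF that] W(4) by (simp add: coboundary_def del: sum.atMost_Suc)
    then show "\<exists>W. open W \<and> y \<in> W \<and> W \<subseteq> U \<and>
        (\<forall>s. singular_simplex (nat (j + 1)) (top_of_set W) s \<longrightarrow> int_coboundary j U \<phi> s = 0)"
      using False W by (intro exI[of _ W]) (simp add: int_coboundary_def nat_add_distrib)
  qed
qed

lemma cochain_section_self: "\<phi> \<in> int_cochains j U \<Longrightarrow> open U \<Longrightarrow> \<phi> \<in> cochain_section j U \<phi>"
  by (simp add: cochain_section_def)

lemma cochain_section_eqI:
  assumes "locally_zero j U (\<lambda>s. \<phi> s - \<psi> s)"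
  shows "cochain_section j U \<phi> = cochain_section j U \<psi>"
proof -
  have "locally_zero j U (\<lambda>s. \<theta> s - \<psi> s) \<longleftrightarrow> locally_zero j U (\<lambda>s. \<theta> s - \<phi> s)" for \<theta>
  proof
    assume "locally_zero j U (\<lambda>s. \<theta> s - \<psi> s)"
    from locally_zero_add[OF this locally_zero_smult[OF assms, of "-1"]]
    show "locally_zero j U (\<lambda>s. \<theta> s - \<phi> s)" by simp
  next
    assume "locally_zero j U (\<lambda>s. \<theta> s - \<phi> s)"
    from locally_zero_add[OF this assms]
    show "locally_zero j U (\<lambda>s. \<theta> s - \<psi> s)" by simp
  qed
  then show ?thesis
    by (simp add: cochain_section_def)
qed

text \<open>Evaluates the operations on sections, which are defined as unions over representatives:
  if the value depends on the section only, all members of the union agree, and there is at least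
  one.\<close>

lemma UN_cochain_section:
  assumes "\<phi> \<in> int_cochains j U" "open U"
    and "\<And>\<theta>. locally_zero j U (\<lambda>s. \<theta> s - \<phi> s) \<Longrightarrow> G \<theta> = G \<phi>"
  shows "(\<Union>\<theta>\<in>cochain_section j U \<phi>. G \<theta>) = G \<phi>"
proof -
  have "(\<Union>\<theta>\<in>cochain_section j U \<phi>. G \<theta>) = (\<Union>_\<in>cochain_section j U \<phi>. G \<phi>)"
    by (intro SUP_cong refl assms(3)) (simp add: cochain_section_def)
  then show ?thesis
    using cochain_section_self[OF assms(1,2)] by auto
qed

lemma cochain_module_add:
  assumes "\<phi> \<in> int_cochains j U" "\<psi> \<in> int_cochains j U" "open U"
  shows "cochain_section j U \<phi> \<oplus>\<^bsub>cochain_module j U\<^esub> cochain_section j U \<psi> =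
    cochain_section j U (\<lambda>s. \<phi> s + \<psi> s)"
proof -
  have "(\<Union>\<psi>'\<in>cochain_section j U \<psi>. cochain_section j U (\<lambda>s. \<theta> s + \<psi>' s))
      = cochain_section j U (\<lambda>s. \<theta> s + \<psi> s)" for \<theta>
    using assms(2,3) by (rule UN_cochain_section) (simp add: cochain_section_eqI)
  moreover have "(\<Union>\<theta>\<in>cochain_section j U \<phi>. cochain_section j U (\<lambda>s. \<theta> s + \<psi> s))
      = cochain_section j U (\<lambda>s. \<phi> s + \<psi> s)"
    using assms(1,3) by (rule UN_cochain_section) (simp add: cochain_section_eqI)
  ultimately show ?thesis
    by (simp add: cochain_module_def)
qed

lemma cochain_module_smult:
  assumes "\<phi> \<in> int_cochains j U" "open U"
  shows "z \<odot>\<^bsub>cochain_module j U\<^esub> cochain_section j U \<phi> = cochain_section j U (\<lambda>s. z * \<phi> s)"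
proof -
  have "(\<Union>\<theta>\<in>cochain_section j U \<phi>. cochain_section j U (\<lambda>s. z * \<theta> s)) = cochain_section j U (\<lambda>s. z * \<phi> s)"
    using assms
    by (rule UN_cochain_section)
       (auto intro!: cochain_section_eqI dest: locally_zero_smult[of _ _ _ z] simp: algebra_simps)
  then show ?thesis
    by (simp add: cochain_module_def)
qed

lemma direct_image_sec [simp]: "csec (direct_image_complex h) j V = cochain_module j (h -` V)"
  by (simp add: direct_image_complex_def)

lemma cochain_module_carrier: "carrier (cochain_module j U) = cochain_section j U ` int_cochains j U"
  by (simp add: cochain_module_def)

lemma cochain_restrict_diff:
  "cochain_restrict j V (\<lambda>s. \<phi> s - \<psi> s) = (\<lambda>s. cochain_restrict j V \<phi> s - cochain_restrict j V \<psi> s)"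
  by (auto simp: cochain_restrict_def)

lemma cochain_restrict_in_cochains [intro]:
  "\<phi> \<in> int_cochains j U \<Longrightarrow> cochain_restrict j V \<phi> \<in> int_cochains j V"
  by (auto simp: int_cochains_def cochains_def cochain_restrict_def)

lemma direct_image_restr:
  assumes "\<phi> \<in> int_cochains j (h -` U)" "open (h -` U)" "open (h -` V)" "V \<subseteq> U"
  shows "restr (obj (direct_image_complex h) j) U V (cochain_section j (h -` U) \<phi>) =
     cochain_section j (h -` V) (cochain_restrict j (h -` V) \<phi>)"
proof -
  have "(\<Union>\<theta>\<in>cochain_section j (h -` U) \<phi>. cochain_section j (h -` V) (cochain_restrict j (h -` V) \<theta>))
      = cochain_section j (h -` V) (cochain_restrict j (h -` V) \<phi>)"
    using assms(1,2)
  proof (rule UN_cochain_section)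
    fix \<theta> assume "locally_zero j (h -` U) (\<lambda>s. \<theta> s - \<phi> s)"
    from locally_zero_restrict[OF this assms(3)] assms(4)
    show "cochain_section j (h -` V) (cochain_restrict j (h -` V) \<theta>) =
        cochain_section j (h -` V) (cochain_restrict j (h -` V) \<phi>)"
      by (intro cochain_section_eqI) (auto simp: cochain_restrict_diff)
  qed
  then show ?thesis
    by (simp add: direct_image_complex_def)
qed

lemma direct_image_dif:
  assumes "\<phi> \<in> int_cochains j (h -` U)" "open (h -` U)"
  shows "dif (direct_image_complex h) j U (cochain_section j (h -` U) \<phi>) =
     cochain_section (j + 1) (h -` U) (int_coboundary j (h -` U) \<phi>)"
proof -
  have "(\<Union>\<theta>\<in>cochain_section j (h -` U) \<phi>. cochain_section (j + 1) (h -` U) (int_coboundary j (h -` U) \<theta>))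
      = cochain_section (j + 1) (h -` U) (int_coboundary j (h -` U) \<phi>)"
    using assms
  proof (rule UN_cochain_section)
    fix \<theta> assume "locally_zero j (h -` U) (\<lambda>s. \<theta> s - \<phi> s)"
    from locally_zero_coboundary[OF this assms(2)]
    show "cochain_section (j + 1) (h -` U) (int_coboundary j (h -` U) \<theta>) =
        cochain_section (j + 1) (h -` U) (int_coboundary j (h -` U) \<phi>)"
      by (intro cochain_section_eqI) (simp add: int_coboundary_linear)
  qed
  then show ?thesis
    by (simp add: direct_image_complex_def)
qed

lemma linear_hom_comp: "f \<in> linear_hom A B \<Longrightarrow> g \<in> linear_hom B C \<Longrightarrow> g \<circ> f \<in> linear_hom A C"
  by (auto simp: linear_hom_def Pi_iff)

text \<open>What multiplication by a cocycle from the right and from the left have in common, just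
  enough to induce a morphism of complexes of sheaves. The axiom \<open>M_coboundary\<close> carries
  no sign, in accordance with \<open>shift_complex\<close>. \<open>M_in\<close> asks nothing of
  \<phi>, since a cup product vanishes off the singular simplices whatever its factors are.\<close>

locale cochain_operator =
  fixes M :: "int \<Rightarrow> 'y::topological_space set \<Rightarrow> 'y cochain \<Rightarrow> 'y cochain" and k :: nat
  assumes M_in: "M j U \<phi> \<in> int_cochains (j + int k) U"
    and M_add: "M j U (\<lambda>s. \<phi> s + \<psi> s) = (\<lambda>s. M j U \<phi> s + M j U \<psi> s)"
    and M_smult: "M j U (\<lambda>s. z * \<phi> s) = (\<lambda>s. z * M j U \<phi> s)"
    and M_local: "open U \<Longrightarrow> locally_zero j U \<phi> \<Longrightarrow> locally_zero (j + int k) U (M j U \<phi>)"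
    and M_restr: "V \<subseteq> U \<Longrightarrow>
      M j V (cochain_restrict j V \<phi>) = cochain_restrict (j + int k) V (M j U \<phi>)"
    and M_coboundary: "\<phi> \<in> int_cochains j U \<Longrightarrow>
      M (j + 1) U (int_coboundary j U \<phi>) = int_coboundary (j + int k) U (M j U \<phi>)"
begin

text \<open>Indexed by the degree \<open>j\<close> of the target; the source has degree
  \<open>j - k\<close>, as in \<open>shift_complex\<close>.\<close>

definition section_map :: "('y \<Rightarrow> 'x) \<Rightarrow> int \<Rightarrow> 'x set \<Rightarrow> 'y cochain set \<Rightarrow> 'y cochain set" where
  "section_map h j V a =
     (\<Union>\<phi>\<in>a. cochain_section j (h -` V) (M (j - int k) (h -` V) \<phi>))"

lemma M_diff: "M j U (\<lambda>s. \<phi> s - \<psi> s) = (\<lambda>s. M j U \<phi> s - M j U \<psi> s)"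
  using M_add[of j U \<phi> "\<lambda>s. -1 * \<psi> s"] M_smult[of j U "-1" \<psi>] by simp

lemma section_map:
  assumes "\<phi> \<in> int_cochains (j - int k) (h -` V)" "open (h -` V)"
  shows "section_map h j V (cochain_section (j - int k) (h -` V) \<phi>) =
     cochain_section j (h -` V) (M (j - int k) (h -` V) \<phi>)"
  unfolding section_map_def
  using assms
proof (rule UN_cochain_section)
  fix \<theta> assume "locally_zero (j - int k) (h -` V) (\<lambda>s. \<theta> s - \<phi> s)"
  from M_local[OF assms(2) this]
  show "cochain_section j (h -` V) (M (j - int k) (h -` V) \<theta>) =
      cochain_section j (h -` V) (M (j - int k) (h -` V) \<phi>)"
    by (intro cochain_section_eqI) (simp add: M_diff)
qed

lemma M_in': "M (j - int k) U \<phi> \<in> int_cochains j U"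
  using M_in[of "j - int k"] by simp

lemma section_map_hom:
  assumes V: "open (h -` V)"
  shows "section_map h j V \<in>
    linear_hom (csec (direct_image_complex h) (j - int k) V) (csec (direct_image_complex h) j V)"
  unfolding linear_hom_def
  using V M_in'
  by (auto simp: cochain_module_carrier section_map cochain_module_add cochain_module_smult M_add M_smult
      int_cochains_closed)

lemma section_map_restr:
  assumes "open (h -` U)" "open (h -` V)" "V \<subseteq> U" "a \<in> carrier (csec (direct_image_complex h) (j - int k) U)"
  shows "restr (obj (direct_image_complex h) j) U V (section_map h j U a) =
     section_map h j V (restr (obj (direct_image_complex h) (j - int k)) U V a)"
proof -
  obtain \<phi> where \<phi>: "\<phi> \<in> int_cochains (j - int k) (h -` U)" "a = cochain_section (j - int k) (h -` U) \<phi>"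
    using assms by (auto simp: cochain_module_carrier)
  have "h -` V \<subseteq> h -` U"
    using assms by auto
  then show ?thesis
    using assms \<phi> M_restr[of "h -` V" "h -` U" "j - int k" \<phi>]
    by (simp add: section_map direct_image_restr M_in' cochain_restrict_in_cochains)
qed

lemma section_map_dif:
  assumes "open (h -` U)" "a \<in> carrier (csec (direct_image_complex h) (j - int k) U)"
  shows "dif (direct_image_complex h) j U (section_map h j U a) =
     section_map h (j + 1) U (dif (direct_image_complex h) (j - int k) U a)"
proof -
  obtain \<phi> where \<phi>: "\<phi> \<in> int_cochains (j - int k) (h -` U)" "a = cochain_section (j - int k) (h -` U) \<phi>"
    using assms by (auto simp: cochain_module_carrier)
  have d: "int_coboundary (j - int k) (h -` U) \<phi> \<in> int_cochains (j + 1 - int k) (h -` U)"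
    unfolding shift_index by (rule int_coboundary_in_cochains)
  have "section_map h (j + 1) U (dif (direct_image_complex h) (j - int k) U a)
      = section_map h (j + 1) U (cochain_section (j + 1 - int k) (h -` U) (int_coboundary (j - int k) (h -` U) \<phi>))"
    using assms \<phi> by (simp add: direct_image_dif shift_index)
  also have "\<dots> = cochain_section (j + 1) (h -` U) (int_coboundary j (h -` U) (M (j - int k) (h -` U) \<phi>))"
    using section_map[OF d assms(1)] M_coboundary[OF \<phi>(1)] by (simp add: shift_index)
  also have "\<dots> = dif (direct_image_complex h) j U (section_map h j U a)"
    using assms \<phi> by (simp add: section_map direct_image_dif M_in')
  finally show ?thesis ..
qed

lemma complex_hom_section_map:
  fixes h :: "'y \<Rightarrow> 'x::topological_space"
  assumes h: "continuous_on UNIV h" and t: "t \<in> complex_hom T (direct_image_complex h)"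
  shows "(\<lambda>j V. section_map h j V \<circ> t (j - int k) V)
     \<in> complex_hom (shift_complex (int k) T) (direct_image_complex h)"
proof -
  have op: "open (h -` U)" if "open U" for U
    using h that by (simp add: open_vimage)
  have lin: "open U \<Longrightarrow> t j U \<in> linear_hom (csec T j U) (csec (direct_image_complex h) j U)"
    and res: "open U \<Longrightarrow> open V \<Longrightarrow> V \<subseteq> U \<Longrightarrow> s \<in> carrier (csec T j U) \<Longrightarrow>
      restr (obj (direct_image_complex h) j) U V (t j U s) = t j V (restr (obj T j) U V s)"
    and dif: "open U \<Longrightarrow> s \<in> carrier (csec T j U) \<Longrightarrow>
      dif (direct_image_complex h) j U (t j U s) = t (j + 1) U (dif T j U s)" for j U V s
    using t by (auto simp: complex_hom_def sheaf_hom_def)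
  show ?thesis
    unfolding complex_hom_def sheaf_hom_def
  proof (intro CollectI conjI allI impI ballI)
    fix j and U :: "'x set" assume "open U"
    then show "section_map h j U \<circ> t (j - int k) U
        \<in> linear_hom (csec (shift_complex (int k) T) j U) (csec (direct_image_complex h) j U)"
      by (simp only: shift_complex_simps) (intro linear_hom_comp[OF lin section_map_hom] op)
  next
    fix j s and U V :: "'x set" assume "open U \<and> open V \<and> V \<subseteq> U" "s \<in> carrier (csec (shift_complex (int k) T) j U)"
    then show "restr (obj (direct_image_complex h) j) U V ((section_map h j U \<circ> t (j - int k) U) s) =
        (section_map h j V \<circ> t (j - int k) V) (restr (obj (shift_complex (int k) T) j) U V s)"
      using section_map_restr[OF op op _ linear_hom_simps(1)[OF lin]] by (simp add: res)
  next
    fix j s and U :: "'x set" assume "open U" "s \<in> carrier (csec (shift_complex (int k) T) j U)"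
    then show "dif (direct_image_complex h) j U ((section_map h j U \<circ> t (j - int k) U) s) =
        (section_map h (j + 1) U \<circ> t (j + 1 - int k) U) (dif (shift_complex (int k) T) j U s)"
      using section_map_dif[OF op linear_hom_simps(1)[OF lin]] by (simp add: dif shift_index)
  qed
qed

end

section \<open>Multiplication on the truncations\<close>

text \<open>Made for cup products: the value of a product on \<open>s\<close> is a multiple of the
  value of \<phi> on a face of \<open>s\<close>, and this face lies in every \<open>W\<close> that
  contains \<open>s\<close>. The degree \<open>n\<close> is kept apart from \<open>j'\<close> since
  it arises as \<open>nat j + k\<close> or \<open>k + nat j\<close>.\<close>

lemma locally_zero_local_multiple:
  assumes "locally_zero j U \<phi>"
    and "\<And>W s. W \<subseteq> U \<Longrightarrow> singular_simplex n (top_of_set W) s \<Longrightarrow>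
      \<exists>s'. singular_simplex (nat j) (top_of_set W) s' \<and> (\<phi> s' = 0 \<longrightarrow> \<psi> s = 0)"
    and "n = nat j'"
  shows "locally_zero j' U \<psi>"
  using assms unfolding locally_zero_def by metis

text \<open>Lets a global cocycle act over every open \<open>U\<close> without being restricted
  first: the coboundary over \<open>U\<close> only evaluates it on faces of simplices in
  \<open>U\<close>.\<close>

lemma coboundary_top_of_set_cocycle:
  assumes "\<psi> \<in> cocycles k euclidean"
  shows "coboundary k (top_of_set U) \<psi> = (\<lambda>_. 0)"
proof (rule ext)
  fix s
  have "coboundary k euclidean \<psi> s = 0"
    using assms by (simp add: cocycles_def)
  moreover have "singular_simplex (Suc k) (top_of_set U) s \<Longrightarrow> singular_simplex (Suc k) euclidean s"
    by (simp add: singular_simplex_subtopology)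
  ultimately show "coboundary k (top_of_set U) \<psi> s = 0"
    by (auto simp: coboundary_def simp del: sum.atMost_Suc split: if_splits)
qed

text \<open>The term with the coboundary of \<psi> drops out of the Leibniz rule, and the remaining
  one has no sign.\<close>

lemma cochain_operator_cup_right:
  fixes \<psi> :: "'y::topological_space cochain"
  assumes \<psi>: "\<psi> \<in> cocycles k euclidean"
  shows "cochain_operator (\<lambda>j U \<phi>. if j < 0 then (\<lambda>_. 0) else cup_cochain (nat j) k (top_of_set U) \<phi> \<psi>) k"
    (is "cochain_operator ?M k")
proof
  fix j and U :: "'y set" and \<phi>
  show "?M j U \<phi> \<in> int_cochains (j + int k) U"
    by (auto simp: int_cochains_def nat_add_distrib)
next
  fix j and U :: "'y set" and \<phi> assume U: "open U" and \<phi>: "locally_zero j U \<phi>"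
  show "locally_zero (j + int k) U (?M j U \<phi>)"
  proof (cases "j < 0")
    case False
    show ?thesis
    proof (rule locally_zero_local_multiple[OF \<phi>, of "nat j + k"])
      fix W :: "'y set" and s assume "singular_simplex (nat j + k) (top_of_set W) s"
      then show "\<exists>s'. singular_simplex (nat j) (top_of_set W) s' \<and> (\<phi> s' = 0 \<longrightarrow> ?M j U \<phi> s = 0)"
        using False by (intro exI[of _ "front_face (nat j) s"]) (simp add: singular_simplex_front_face cup_cochain_def)
    qed (use False in simp)
  qed (simp add: U)
next
  fix j and U V :: "'y set" and \<phi> assume VU: "V \<subseteq> U"
  show "?M j V (cochain_restrict j V \<phi>) = cochain_restrict (j + int k) V (?M j U \<phi>)"
  proof (cases "j < 0")
    case False
    then have "nat (j + int k) = nat j + k" by simp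
    then show ?thesis
      using False VU by (auto simp: fun_eq_iff cup_cochain_def cochain_restrict_def
          intro: singular_simplex_front_face singular_simplex_top_of_set_mono)
  qed (simp add: cochain_restrict_def)
next
  fix j and U :: "'y set" and \<phi> assume \<phi>: "\<phi> \<in> int_cochains j U"
  show "?M (j + 1) U (int_coboundary j U \<phi>) = int_coboundary (j + int k) U (?M j U \<phi>)"
  proof (cases "j < 0")
    \<comment> \<open>For \<open>j = -1\<close> the left side already is a cup product, with a
      factor of degree 0, but that factor is the zero cochain.\<close>
    case True
    then show ?thesis
      by (simp add: int_coboundary_linear int_coboundary_def cup_cochain_bilinear)
  next
    case False
    then have "nat (j + 1) = Suc (nat j)" "nat (j + int k) = nat j + k" by simp_all
    then show ?thesis
      using False coboundary_cup_cochain[of "nat j" k "top_of_set U" \<phi> \<psi>]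
      by (simp add: int_coboundary_def coboundary_top_of_set_cocycle[OF \<psi>] cup_cochain_bilinear fun_eq_iff)
  qed
qed (simp_all add: cup_cochain_bilinear)

text \<open>The sign makes left multiplication commute with the coboundary; it is normalized to be
  \<open>1\<close> in degree \<open>i\<close>.\<close>

lemma cochain_operator_cup_left:
  fixes \<psi> :: "'y::topological_space cochain"
  assumes \<psi>: "\<psi> \<in> cocycles k euclidean"
  shows "cochain_operator (\<lambda>j U \<phi>. if j < 0 then (\<lambda>_. 0)
    else (\<lambda>s. (-1) ^ (k * (nat j + i)) * cup_cochain k (nat j) (top_of_set U) \<psi> \<phi> s)) k"
    (is "cochain_operator ?M k")
proof
  fix j and U :: "'y set" and \<phi>
  show "?M j U \<phi> \<in> int_cochains (j + int k) U"
    by (auto simp: int_cochains_def nat_add_distrib add.commute[of "nat j"])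
next
  fix j and U :: "'y set" and \<phi> assume U: "open U" and \<phi>: "locally_zero j U \<phi>"
  show "locally_zero (j + int k) U (?M j U \<phi>)"
  proof (cases "j < 0")
    case False
    show ?thesis
    proof (rule locally_zero_local_multiple[OF \<phi>, of "k + nat j"])
      fix W :: "'y set" and s assume "singular_simplex (k + nat j) (top_of_set W) s"
      then show "\<exists>s'. singular_simplex (nat j) (top_of_set W) s' \<and> (\<phi> s' = 0 \<longrightarrow> ?M j U \<phi> s = 0)"
        using False by (intro exI[of _ "back_face k (nat j) s"]) (simp add: singular_simplex_back_face cup_cochain_def)
    qed (use False in simp)
  qed (simp add: U)
next
  fix j and U V :: "'y set" and \<phi> assume VU: "V \<subseteq> U"
  show "?M j V (cochain_restrict j V \<phi>) = cochain_restrict (j + int k) V (?M j U \<phi>)"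
  proof (cases "j < 0")
    case False
    then have "nat (j + int k) = k + nat j" by simp
    then show ?thesis
      using False VU by (auto simp: fun_eq_iff cup_cochain_def cochain_restrict_def
          intro: singular_simplex_back_face singular_simplex_top_of_set_mono)
  qed (simp add: cochain_restrict_def)
next
  fix j and U :: "'y set" and \<phi> assume \<phi>: "\<phi> \<in> int_cochains j U"
  show "?M (j + 1) U (int_coboundary j U \<phi>) = int_coboundary (j + int k) U (?M j U \<phi>)"
  proof (cases "j < 0")
    case True
    then show ?thesis
      by (simp add: int_coboundary_linear int_coboundary_def cup_cochain_bilinear)
  next
    case False
    then have "nat (j + 1) = Suc (nat j)" "nat (j + int k) = k + nat j" by simp_all
    \<comment> \<open>Raising \<open>j\<close> by one multiplies the normalizing sign by
      \<open>(-1) ^ k\<close>, the sign in the Leibniz rule for a left factor of degree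
      \<open>k\<close>.\<close>
    then show ?thesis
      using False coboundary_cup_cochain[of k "nat j" "top_of_set U" \<psi> \<phi>]
      by (simp add: int_coboundary_def coboundary_linear coboundary_top_of_set_cocycle[OF \<psi>]
          cup_cochain_bilinear fun_eq_iff power_add algebra_simps)
  qed
qed (simp_all add: cup_cochain_bilinear algebra_simps)

text \<open>As \<eta> is a cochain on all of \<open>Y\<close>, adding its coboundary to \<theta>
  does not change the class, and the sum is the representative that
  \<open>hypercohomology_image\<close> asks for.\<close>

lemma hypercohomology_imageI:
  assumes \<theta>: "\<theta> \<in> cocycles n euclidean" and \<eta>: "\<eta> \<in> int_cochains (int n - 1) UNIV"
    and c: "c \<in> cycle_sections T (int n) UNIV"
    and tc: "t (int n) UNIV c = cochain_section (int n) UNIV (\<lambda>s. \<theta> s + int_coboundary (int n - 1) UNIV \<eta> s)"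
  shows "cohomology_class n euclidean \<theta> \<in> hypercohomology_image n T t"
proof -
  let ?b = "int_coboundary (int n - 1) UNIV \<eta>"
  \<comment> \<open>For \<open>n = 0\<close> the coboundary comes from degree \<open>-1\<close> and
    is zero by definition.\<close>
  have b: "?b \<in> coboundaries n euclidean"
    using \<eta> by (cases n) (auto simp: int_coboundary_def coboundaries_def int_cochains_def)
  then have "?b \<in> cocycles n euclidean"
    using coboundaries_subset_cocycles by auto
  with \<theta> have "(\<lambda>s. \<theta> s + ?b s) \<in> cocycles n euclidean"
    by (auto simp: cocycles_def coboundary_linear fun_eq_iff)
  with b have "(\<lambda>s. \<theta> s + ?b s) \<in> cohomology_class n euclidean \<theta>"
    by (simp add: cohomology_class_def)
  moreover have "cohomology_class n euclidean \<theta> \<in> singular_cohomology n euclidean"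
    using \<theta> by (simp add: singular_cohomology_def)
  ultimately show ?thesis
    unfolding hypercohomology_image_def using c tc by blast
qed

text \<open>Requires no group structure on the target, unlike \<open>linear_hom_zero\<close>. If the
  target consists of classes of cochains, \<open>cochain_module_smult\<close> evaluates the
  right-hand side to the zero class.\<close>

lemma linear_hom_module_zero:
  assumes "f \<in> linear_hom M N" "Module.module ring_of_type_algebra M"
  shows "f \<zero>\<^bsub>M\<^esub> = 0 \<odot>\<^bsub>N\<^esub> f \<zero>\<^bsub>M\<^esub>"
proof -
  interpret Module.module ring_of_type_algebra M by fact
  have "0 \<odot>\<^bsub>M\<^esub> \<zero>\<^bsub>M\<^esub> = \<zero>\<^bsub>M\<^esub>"
    using smult_r_null[of 0] by (simp add: ring_of_type_algebra_def)
  then show ?thesis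
    using linear_hom_simps(3)[OF assms(1), of "\<zero>\<^bsub>M\<^esub>" 0] by simp
qed

context cochain_operator
begin

text \<open>The operator induces a morphism from \<open>T\<close> shifted by \<open>k\<close> to the direct image. The shift raises
  the perversity by \<open>k\<close>, so the morphism factors through the truncation \<open>T'\<close> in the derived
  category; this is made explicit on global sections.\<close>

lemma perverse_truncation_operator:
  fixes h :: "'y \<Rightarrow> complex^'N::finite"
  assumes h: "continuous_on UNIV h"
    and T: "perverse_truncation l T t (direct_image_complex h)"
    and T': "perverse_truncation (l + int k) T' t' (direct_image_complex h)"
    and c: "c \<in> cycle_sections T (int m) UNIV"
    and \<phi>: "\<phi> \<in> int_cochains (int m) UNIV" "t (int m) UNIV c = cochain_section (int m) UNIV \<phi>"
  obtains c' \<eta> where "c' \<in> cycle_sections T' (int (m + k)) UNIV" "\<eta> \<in> int_cochains (int (m + k) - 1) UNIV"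
    "t' (int (m + k)) UNIV c' = cochain_section (int (m + k)) UNIV
       (\<lambda>s. M (int m) UNIV \<phi> s + int_coboundary (int (m + k) - 1) UNIV \<eta> s)"
proof -
  define n where "n = int (m + k)"
  have n: "n - int k = int m" by (simp add: n_def)
  define F where "F = direct_image_complex h"
  have F: "csec F j UNIV = cochain_module j UNIV" for j
    by (simp add: F_def)
  define K where "K = shift_complex (int k) T"
  define f where "f = (\<lambda>j V. section_map h j V \<circ> t (j - int k) V)"
  have t: "t \<in> complex_hom T F" and pT: "perverse_le l T"
    using T by (auto simp: perverse_truncation_def F_def)
  have t': "t' \<in> complex_hom T' F" and pT': "perverse_le (l + int k) T'"
    using T' by (auto simp: perverse_truncation_def F_def)
  have pK: "perverse_le (l + int k) K"
    unfolding K_def using pT by (rule perverse_le_shift)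
  have f: "f \<in> complex_hom K F"
    unfolding f_def K_def F_def using h t by (intro complex_hom_section_map) (simp_all add: F_def)
  \<comment> \<open>The factorization \<open>g\<close> exists only on some \<open>K'\<close>
    quasi-isomorphic to \<open>K\<close>, and there \<open>t' g\<close> and \<open>f u\<close> agree
    only in the derived category. A second replacement \<open>K''\<close> carries a homotopy between
    them.\<close>
  obtain K' :: "(complex^'N, universe) sheaf_complex" and u g
    where K': "flabby_complex K'" and u: "quasi_iso K' K u" and g: "g \<in> complex_hom K' T'"
      and eq: "derived_eq K' F (comp_hom t' g) (comp_hom f u)"
    using T' pK f unfolding perverse_truncation_def F_def by blast
  obtain K'' :: "(complex^'N, universe) sheaf_complex" and u'
    where K'': "flabby_complex K''" and u': "quasi_iso K'' K' u'"
      and hom: "homotopic_homs K'' F (comp_hom (comp_hom t' g) u') (comp_hom (comp_hom f u) u')"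
    using eq unfolding derived_eq_def by blast
  obtain H where H: "H j \<in> sheaf_hom (obj K'' j) (obj F (j - 1))"
    and Heq: "s \<in> carrier (csec K'' j UNIV) \<Longrightarrow>
      comp_hom (comp_hom t' g) u' j UNIV s = comp_hom (comp_hom f u) u' j UNIV s \<oplus>\<^bsub>csec F j UNIV\<^esub>
        (dif F (j - 1) UNIV (H j UNIV s) \<oplus>\<^bsub>csec F j UNIV\<^esub> H (j + 1) UNIV (dif K'' j UNIV s))" for j s
    using hom open_UNIV unfolding homotopic_homs_def by metis
  interpret u: cplx_map K' K u
    using K' u pK by unfold_locales (auto simp: perverse_le_def quasi_iso_def)
  interpret u': cplx_map K'' K' u'
    using K'' K' u' by unfold_locales (auto simp: quasi_iso_def)
  interpret g: cplx_map K' T' g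
    using K' g pT' by unfold_locales (auto simp: perverse_le_def)
  have cK: "c \<in> cycle_sections K n UNIV"
    using c by (simp add: K_def n)
  \<comment> \<open>The cycle \<open>c\<close> need not be the image of a section of
    \<open>K'\<close>. It is lifted up to a coboundary, to \<open>K'\<close> and then to
    \<open>K''\<close>; the two corrections are collected in \<open>e2\<close>, leaving
    \<open>c = r + d e2\<close>.\<close>
  obtain s e where s: "s \<in> cycle_sections K' n UNIV" and e: "e \<in> carrier (csec K (n - 1) UNIV)"
    and c_eq: "c = u n UNIV s \<oplus>\<^bsub>csec K n UNIV\<^esub> dif K (n - 1) UNIV e"
    by (rule u.quasi_iso_cycle_lift[OF u open_UNIV cK])
  obtain s' e' where s': "s' \<in> cycle_sections K'' n UNIV" and e': "e' \<in> carrier (csec K' (n - 1) UNIV)"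
    and s_eq: "s = u' n UNIV s' \<oplus>\<^bsub>csec K' n UNIV\<^esub> dif K' (n - 1) UNIV e'"
    by (rule u'.quasi_iso_cycle_lift[OF u' open_UNIV s])
  note s'c = u'.K.cycle_sectionsD[OF s']
  define r where "r = u n UNIV (u' n UNIV s')"
  have r: "r \<in> carrier (csec K n UNIV)"
    using s'c by (simp add: r_def)
  define e2 where "e2 = u (n - 1) UNIV e' \<oplus>\<^bsub>csec K (n - 1) UNIV\<^esub> e"
  interpret Kn: abelian_group "csec K n UNIV" by (intro u.L.is_abelian_group open_UNIV)
  interpret Kn1: abelian_group "csec K (n - 1) UNIV" by (intro u.L.is_abelian_group open_UNIV)
  have e2: "e2 \<in> carrier (csec K (n - 1) UNIV)"
    using e e' by (simp add: e2_def)
  have c_eq2: "c = r \<oplus>\<^bsub>csec K n UNIV\<^esub> dif K (n - 1) UNIV e2"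
    using c_eq s_eq s'c e e' by (simp add: r_def e2_def u.hom_dif' Kn.a_assoc)
  have flin: "f j UNIV \<in> linear_hom (csec K j UNIV) (csec F j UNIV)" for j
    using f by (simp add: complex_hom_def sheaf_hom_def)
  have fdif: "f n UNIV (dif K (n - 1) UNIV e2) = dif F (n - 1) UNIV (f (n - 1) UNIV e2)"
  proof -
    have "dif F (n - 1) UNIV (f (n - 1) UNIV e2) = f (n - 1 + 1) UNIV (dif K (n - 1) UNIV e2)"
      using f e2 open_UNIV unfolding complex_hom_def by blast
    then show ?thesis by simp
  qed
  have Fcar: "\<exists>\<alpha>\<in>int_cochains j UNIV. a = cochain_section j UNIV \<alpha>" if "a \<in> carrier (csec F j UNIV)" for a j
    using that by (auto simp: F cochain_module_carrier)
  obtain \<alpha> where \<alpha>: "\<alpha> \<in> int_cochains n UNIV" "f n UNIV r = cochain_section n UNIV \<alpha>"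
    using Fcar linear_hom_simps(1)[OF flin r] by blast
  obtain \<beta> where \<beta>: "\<beta> \<in> int_cochains (n - 1) UNIV" "f (n - 1) UNIV e2 = cochain_section (n - 1) UNIV \<beta>"
    using Fcar linear_hom_simps(1)[OF flin e2] by blast
  have Hlin: "H j UNIV \<in> linear_hom (csec K'' j UNIV) (csec F (j - 1) UNIV)" for j
    using H by (simp add: sheaf_hom_def)
  obtain \<gamma> where \<gamma>: "\<gamma> \<in> int_cochains (n - 1) UNIV" "H n UNIV s' = cochain_section (n - 1) UNIV \<gamma>"
    using Fcar linear_hom_simps(1)[OF Hlin s'c(1)] by blast
  \<comment> \<open>One of the two homotopy terms vanishes because \<open>s'\<close> is a
    cycle.\<close>
  have H0: "H (n + 1) UNIV (dif K'' n UNIV s') = cochain_section n UNIV (\<lambda>_. 0)"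
  proof -
    have "H (n + 1) UNIV \<zero>\<^bsub>csec K'' (n + 1) UNIV\<^esub> \<in> carrier (csec F n UNIV)"
      using linear_hom_simps(1)[OF Hlin, of _ "n + 1"] abelian_monoid.zero_closed[OF abelian_group.axioms(1)[OF u'.K.is_abelian_group[OF open_UNIV]]]
      by simp
    then obtain \<delta> where "\<delta> \<in> int_cochains n UNIV" "H (n + 1) UNIV \<zero>\<^bsub>csec K'' (n + 1) UNIV\<^esub> = cochain_section n UNIV \<delta>"
      using Fcar by blast
    then show ?thesis
      using linear_hom_module_zero[OF Hlin u'.K.is_module[OF open_UNIV], of "n + 1"] s'c(2)
      by (simp add: F cochain_module_smult)
  qed
  have d: "int_coboundary (n - 1) UNIV \<eta> \<in> int_cochains n UNIV" for \<eta> :: "'y cochain"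
    using int_coboundary_in_cochains[of "n - 1" UNIV \<eta>] by simp
  have dF: "dif F (n - 1) UNIV (cochain_section (n - 1) UNIV \<eta>)
      = cochain_section n UNIV (int_coboundary (n - 1) UNIV \<eta>)"
    if "\<eta> \<in> int_cochains (n - 1) UNIV" for \<eta>
    using direct_image_dif[of \<eta> "n - 1" h UNIV] that by (simp add: F_def)
  have addF: "cochain_section n UNIV \<phi> \<oplus>\<^bsub>csec F n UNIV\<^esub> cochain_section n UNIV \<psi> =
      cochain_section n UNIV (\<lambda>s. \<phi> s + \<psi> s)"
    if "\<phi> \<in> int_cochains n UNIV" "\<psi> \<in> int_cochains n UNIV" for \<phi> \<psi> :: "'y cochain"
    using cochain_module_add[OF that] by (simp add: F)
  define \<mu> where "\<mu> = M (int m) UNIV \<phi>"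
  have \<mu>: "\<mu> \<in> int_cochains n UNIV"
    using M_in[of "int m" UNIV \<phi>] by (simp add: \<mu>_def n_def)
  have "f n UNIV c = cochain_section n UNIV \<mu>"
    using section_map[of \<phi> n h UNIV] \<phi> by (simp add: f_def n \<mu>_def)
  moreover have "f n UNIV c = cochain_section n UNIV (\<lambda>s. \<alpha> s + int_coboundary (n - 1) UNIV \<beta> s)"
    using linear_hom_simps(2)[OF flin r] e2 \<alpha> \<beta> d by (simp add: c_eq2 fdif dF addF)
  ultimately have \<mu>_eq: "cochain_section n UNIV \<mu> = cochain_section n UNIV (\<lambda>s. \<alpha> s + int_coboundary (n - 1) UNIV \<beta> s)"
    by simp
  \<comment> \<open>Passing from \<open>f r\<close> to \<open>t' c'\<close> adds the coboundary of
    \<gamma>, from the homotopy; passing from \<open>f r\<close> to \<open>f c\<close> adds that of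
    \<beta>, from the lifting. Their difference separates \<open>t' c'\<close> from the section of
    \<mu>.\<close>
  define \<eta> where "\<eta> = (\<lambda>s. \<gamma> s - \<beta> s)"
  have \<eta>: "\<eta> \<in> int_cochains (n - 1) UNIV"
    using \<gamma>(1) \<beta>(1) unfolding \<eta>_def by (rule int_cochains_closed)
  \<comment> \<open>The homotopy is defined on \<open>K''\<close> only, so the cycle is obtained
    from \<open>s'\<close> and not from \<open>s\<close>.\<close>
  define c' where "c' = g n UNIV (u' n UNIV s')"
  have "dif K' n UNIV (u' n UNIV s') = \<zero>\<^bsub>csec K' (n + 1) UNIV\<^esub>"
    using s'c by (simp flip: u'.hom_dif)
  then have c': "c' \<in> cycle_sections T' n UNIV"
    using s'c by (simp add: c'_def cycle_sections_def flip: g.hom_dif)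
  have "t' n UNIV c' = f n UNIV r \<oplus>\<^bsub>csec F n UNIV\<^esub>
      (dif F (n - 1) UNIV (H n UNIV s') \<oplus>\<^bsub>csec F n UNIV\<^esub> H (n + 1) UNIV (dif K'' n UNIV s'))"
    using Heq[OF s'c(1)] by (simp add: c'_def r_def comp_hom_def)
  also have "\<dots> = cochain_section n UNIV (\<lambda>s. \<alpha> s + int_coboundary (n - 1) UNIV \<gamma> s)"
    using \<alpha> \<gamma> d by (simp add: H0 dF addF int_cochains_closed)
  also have "(\<lambda>s. \<alpha> s + int_coboundary (n - 1) UNIV \<gamma> s) =
      (\<lambda>s. (\<alpha> s + int_coboundary (n - 1) UNIV \<beta> s) + int_coboundary (n - 1) UNIV \<eta> s)"
    by (simp add: \<eta>_def int_coboundary_linear)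
  \<comment> \<open>By \<open>\<mu>_eq\<close> only sections agree; the cochains may differ by a
    locally zero one. The sum is therefore split into sections before \<mu> is put in.\<close>
  also have "cochain_section n UNIV \<dots> = cochain_section n UNIV (\<lambda>s. \<alpha> s + int_coboundary (n - 1) UNIV \<beta> s)
      \<oplus>\<^bsub>csec F n UNIV\<^esub> cochain_section n UNIV (int_coboundary (n - 1) UNIV \<eta>)"
    using \<alpha> d by (simp add: addF int_cochains_closed)
  also have "\<dots> = cochain_section n UNIV (\<lambda>s. \<mu> s + int_coboundary (n - 1) UNIV \<eta> s)"
    using \<mu> d by (simp add: addF flip: \<mu>_eq)
  finally show ?thesis
    using that[of c' \<eta>] c' \<eta> by (simp add: n_def \<mu>_def)
qed

end

text \<open>On the domain of a chart \<open>h\<close> is its coordinate expression, continuous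
  because its components are differentiable, composed with the chart. Continuity makes preimages
  under \<open>h\<close> open, as the calculus with cochain sections requires.\<close>

lemma holo_map_from_continuous:
  assumes A: "complex_manifold A" and h: "holo_map_from A h"
  shows "continuous_on UNIV h"
proof -
  have "isCont h y" for y
  proof -
    obtain c where c: "c \<in> A" "y \<in> fst c"
      using A unfolding complex_manifold_def by blast
    then have oc: "open (fst c)" "open (snd c ` fst c)"
      and hom: "homeomorphism (fst c) (snd c ` fst c) (snd c) (chart_inv c)"
      using A unfolding complex_manifold_def by blast+
    have "isCont (\<lambda>z. (h \<circ> chart_inv c) z $ i) z" if "z \<in> snd c ` fst c" for z i
      using h c that unfolding holo_map_from_def holo_map_on_def holo_fun_on_def
      by (meson has_derivative_continuous)
    then have "isCont (h \<circ> chart_inv c) z" if "z \<in> snd c ` fst c" for z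
      using that unfolding isCont_def by (intro vec_tendstoI) auto
    then have "continuous_on (snd c ` fst c) (h \<circ> chart_inv c)"
      by (intro continuous_at_imp_continuous_on ballI)
    then have "continuous_on (fst c) (h \<circ> chart_inv c \<circ> snd c)"
      using hom continuous_on_compose[of "fst c" "snd c" "h \<circ> chart_inv c"]
      by (simp add: homeomorphism_def)
    then have "continuous_on (fst c) h"
      by (rule continuous_on_eq) (use hom in \<open>auto simp: homeomorphism_def\<close>)
    then show ?thesis
      using oc c by (simp add: continuous_on_eq_continuous_at)
  qed
  then show ?thesis
    by (simp add: continuous_at_imp_continuous_on)
qed

theorem theorem1p11:
  fixes A :: "('y::{t2_space,second_countable_topology}, 'n::finite) chart set"
    and \<omega> :: "('y, 'n) two_form"
    and h :: "'y \<Rightarrow> complex^'N::finite"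
    and P :: "int \<Rightarrow> nat \<Rightarrow> 'y cochain set set"
    and k1 k2 :: nat
    and a1 a2 :: int
  assumes "hybrid_LG_model A \<omega> h"
    and "perverse_Leray_filtration h P"
    and "0 \<le> a1" "a1 \<le> int CARD('N)"
    and "0 \<le> a2" "a2 \<le> int CARD('N)"
    and "x \<in> P (int k1 + a1) k1"
    and "y \<in> P (int k2 + a2) k2"
  shows "cup k1 k2 euclidean x y \<in> P (int (k1 + k2) + min a1 a2) (k1 + k2)"
proof -
  have h: "continuous_on UNIV h"
    using assms(1) holo_map_from_continuous by (auto simp: hybrid_LG_model_def)
  obtain T1 t1 where T1: "perverse_truncation (int k1 + a1) T1 t1 (direct_image_complex h)"
    and P1: "P (int k1 + a1) k1 = hypercohomology_image k1 T1 t1"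
    using assms(2) unfolding perverse_Leray_filtration_def by metis
  obtain T2 t2 where T2: "perverse_truncation (int k2 + a2) T2 t2 (direct_image_complex h)"
    and P2: "P (int k2 + a2) k2 = hypercohomology_image k2 T2 t2"
    using assms(2) unfolding perverse_Leray_filtration_def by metis
  obtain T t where T: "perverse_truncation (int (k1 + k2) + min a1 a2) T t (direct_image_complex h)"
    and P: "P (int (k1 + k2) + min a1 a2) (k1 + k2) = hypercohomology_image (k1 + k2) T t"
    using assms(2) unfolding perverse_Leray_filtration_def by metis
  obtain \<phi> c1 where x: "x \<in> singular_cohomology k1 euclidean" "\<phi> \<in> x"
    and c1: "c1 \<in> cycle_sections T1 (int k1) UNIV" "t1 (int k1) UNIV c1 = cochain_section (int k1) UNIV \<phi>"
    using assms(7) unfolding P1 hypercohomology_image_def by blast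
  obtain \<psi> c2 where y: "y \<in> singular_cohomology k2 euclidean" "\<psi> \<in> y"
    and c2: "c2 \<in> cycle_sections T2 (int k2) UNIV" "t2 (int k2) UNIV c2 = cochain_section (int k2) UNIV \<psi>"
    using assms(8) unfolding P2 hypercohomology_image_def by blast
  have \<phi>: "\<phi> \<in> cocycles k1 euclidean" "\<phi> \<in> int_cochains (int k1) UNIV"
    and \<psi>: "\<psi> \<in> cocycles k2 euclidean" "\<psi> \<in> int_cochains (int k2) UNIV"
    using singular_cohomology_member(1)[OF x] singular_cohomology_member(1)[OF y]
    by (auto simp: cocycles_def int_cochains_def)
  let ?\<theta> = "cup_cochain k1 k2 euclidean \<phi> \<psi>"
  have \<theta>: "?\<theta> \<in> cocycles (k1 + k2) euclidean"
    using \<phi> \<psi> by (intro cup_cochain_cocycle)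
  obtain c \<eta> where c: "c \<in> cycle_sections T (int (k1 + k2)) UNIV" "\<eta> \<in> int_cochains (int (k1 + k2) - 1) UNIV"
    "t (int (k1 + k2)) UNIV c = cochain_section (int (k1 + k2)) UNIV
       (\<lambda>s. ?\<theta> s + int_coboundary (int (k1 + k2) - 1) UNIV \<eta> s)"
  proof (cases "a1 \<le> a2")
    \<comment> \<open>Here \<open>min a1 a2 = a1\<close>: the cycle that represents \<open>x\<close>
      is transported, and \<open>y\<close> enters only through its cocycle \<psi>, whose degree
      \<open>k2\<close> is added to \<open>k1 + a1\<close>.\<close>
    case True
    interpret cochain_operator
      "\<lambda>j U \<phi>. if j < 0 then (\<lambda>_. 0) else cup_cochain (nat j) k2 (top_of_set U) \<phi> \<psi>" k2
      using \<psi>(1) by (rule cochain_operator_cup_right)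
    have "perverse_truncation (int k1 + a1 + int k2) T t (direct_image_complex h)"
      using T True by (simp add: algebra_simps)
    from perverse_truncation_operator[OF h T1 this c1(1) \<phi>(2) c1(2)] show ?thesis
      using that by auto
  next
    case False
    \<comment> \<open>With \<open>i = k2\<close> the exponent in degree \<open>k2\<close> is
      \<open>k1 * (k2 + k2)\<close>, which is even, so the operator sends the cocycle of
      \<open>y\<close> to the cup product itself.\<close>
    interpret cochain_operator
      "\<lambda>j U \<psi>. if j < 0 then (\<lambda>_. 0)
         else (\<lambda>s. (-1) ^ (k1 * (nat j + k2)) * cup_cochain k1 (nat j) (top_of_set U) \<phi> \<psi> s)" k1
      using \<phi>(1) by (rule cochain_operator_cup_left)
    have "perverse_truncation (int k2 + a2 + int k1) T t (direct_image_complex h)"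
      using T False by (simp add: algebra_simps)
    from perverse_truncation_operator[OF h T2 this c2(1) \<psi>(2) c2(2)] show ?thesis
      using that by (auto simp: add.commute[of k2 k1])
  qed
  show ?thesis
    unfolding P cup_eq_cohomology_class[OF x(1) y(1) x(2) y(2)]
    using \<theta> c(2,1,3) by (rule hypercohomology_imageI)
qed

end
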